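(* Let $(Y_n,\Gamma_n)_{n\in\mathbb{N}_0}$, $Y_n=(X_n,\phi_n)$, be an AIR MCMC chain with parameter $\beta\ge 1$ in the setting described in the context, and let $d\colon\mathcal{Y}\times\mathcal{Y}\to[0,\infty)$ be a distance-like function with associated contraction coefficient $\tau(\cdot)$ and eccentricities $E_\gamma$. Assume: (1) there are $M\in[1,\infty)$, $\tau\in[0,1)$ and $k_0\in\mathbb{N}$, independent of $\gamma$, such that $\tau(P_\gamma)\le M$ and $\tau(P_\gamma^{k_0})\le\tau$ for all $\gamma\in\mathcal{I}$; (2) there is $K\in(0,\infty)$ such that $E_\gamma(y)\le K$ for all $\gamma\in\mathcal{I}$ and $y\in\mathcal{Y}$. Let $f\colon\mathcal{X}\to\mathbb{R}$ be a measurable function such that $h=h_f\colon\mathcal{Y}\to\mathbb{R}$, $h(x,\phi)=f(x)$, is bounded and Lipschitz with some constant $L\in(0,\infty)$ with respect to $d$. Then for every $\varepsilon>0$, $$\lim_{n\to\infty}\frac{1}{\sqrt{n}\,(\log n)^{1/2+\varepsilon}}\sum_{j=1}^n\bigl(f(X_j)-\nu(f)\bigr)=0\qquad\text{almost surely}.$$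
   Context: Setting. $(\mathcal{X},\mathcal{F}_\mathcal{X},\nu)$ is a probability space, $(\Phi,\mathcal{F}_\Phi)$ is a measurable space, and $\mathcal{Y}=\mathcal{X}\times\Phi$ with $\mathcal{F}_\mathcal{Y}=\mathcal{F}_\mathcal{X}\otimes\mathcal{F}_\Phi$; these are Polish spaces with their (countably generated) Borel $\sigma$-algebras, and $d_\mathcal{Y}$ denotes a metric inducing the Polish topology of $\mathcal{Y}$. $(\mathcal{I},\mathcal{F}_\mathcal{I})$ is a measurable space. $\{\pi_\gamma\}_{\gamma\in\mathcal{I}}$ is a family of probability measures on $\mathcal{Y}$ and $\{P_\gamma\}_{\gamma\in\mathcal{I}}$ a family of transition kernels on $\mathcal{Y}$ such that for every $\gamma$: $\pi_\gamma(B\times\Phi)=\nu(B)$ for all $B\in\mathcal{F}_\mathcal{X}$; $\pi_\gamma$ is the invariant distribution of $P_\gamma$; $P_\gamma$ is $\psi$-irreducible and aperiodic. Moreover $(y,\gamma)\mapsto P_\gamma(y,A)$ is measurable for every $A\in\mathcal{F}_\mathcal{Y}$. Write $\nu(f)=\int f\,d\nu$. AIR MCMC chain with parameter $\beta>0$. Put $k_j=\lceil j^\beta\rceil$, $T_0=0$, $T_m=\sum_{j=1}^m k_j$. The chain is a process $(Y_n,\Gamma_n)_{n\in\mathbb{N}_0}$ on a probability space $(\Omega,\mathcal{F},\mathbb{P})$ with values in $\mathcal{Y}\times\mathcal{I}$ such that: $(Y_0,\Gamma_0)=(y_0,\gamma_0)$ is deterministic; with $\mathcal{F}_n=\sigma(Y_0,\dots,Y_n,\Gamma_0,\dots,\Gamma_n)$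 one has $\mathbb{P}[Y_{n+1}\in B\mid\mathcal{F}_n]=P_{\Gamma_n}(Y_n,B)$ a.s. for all $B\in\mathcal{F}_\mathcal{Y}$; $\Gamma_n=U_n(Y_0,\dots,Y_n,\Gamma_0,\dots,\Gamma_{n-1})$ for measurable maps $U_n\colon\mathcal{Y}^{n+1}\times\mathcal{I}^n\to\mathcal{I}$; adaptation happens only at the times $T_m$, i.e. $\Gamma_{i_1}=\Gamma_{i_2}$ whenever $i_1,i_2\in\{T_j,\dots,T_{j+1}-1\}$ for some $j$; and $\omega\mapsto\pi_{\Gamma_n(\omega)}(g)$ is measurable for every measurable $g\colon\mathcal{Y}\to\mathbb{R}$ with $\pi_\gamma(|g|)<\infty$ for all $\gamma$. Write $Y_n=(X_n,\phi_n)$ with $X_n\in\mathcal{X}$, $\phi_n\in\Phi$. Distance-like function: $d\colon\mathcal{Y}\times\mathcal{Y}\to[0,\infty)$ that is symmetric, satisfies $d(x,y)=0\iff x=y$, and is lower semi-continuous w.r.t. the product topology induced by $d_\mathcal{Y}$ (no triangle inequality required). Wasserstein-like function: $\mathcal{W}(\mu_1,\mu_2)=\inf_\xi\int d(x,y)\,\xi(dx,dy)$, infimum over all couplings $\xi$ of the probability measures $\mu_1,\mu_2$. Contraction coefficient: $\tau(P_\gamma^\ell)=\sup_{y_1\ne y_2}\mathcal{W}(P_\gamma^\ell(y_1,\cdot),P_\gamma^\ell(y_2,\cdot))/d(y_1,y_2)$. Eccentricity: $E_\gamma(y)=\int_\mathcal{Y}d(y,y')\,\pi_\gamma(dy')$.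 A function $\psi$ is Lipschitz with constant $L$ w.r.t. $d$ if $|\psi(x)-\psi(y)|\le L\,d(x,y)$ for all $x,y$. *)

theory Defs
  imports "HOL-Probability.Probability"
begin

section \<open>Transition kernels\<close>

fun kernel_pow :: "('a::topological_space \<Rightarrow> 'a measure) \<Rightarrow> nat \<Rightarrow> 'a \<Rightarrow> 'a measure" where
  "kernel_pow K 0 y = return borel y"
| "kernel_pow K (Suc n) y = K y \<bind> kernel_pow K n"

text \<open>\<open>\<psi>\<close>-irreducibility and aperiodicity follow Meyn and Tweedie, \<open>Markov Chains and Stochastic
  Stability\<close>: \<open>\<psi>\<close> denotes a maximal irreducibility measure, and a chain is aperiodic if the largest
  \<open>k\<close> for which a \<open>k\<close>-cycle occurs is 1. All maximal irreducibility measures are equivalent, so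
  aperiodicity does not depend on the choice of \<open>\<psi>\<close>.\<close>

definition irreducibility_measure :: "('a::topological_space \<Rightarrow> 'a measure) \<Rightarrow> 'a measure \<Rightarrow> bool" where
  "irreducibility_measure K \<phi> \<longleftrightarrow>
     sets \<phi> = sets borel \<and> sigma_finite_measure \<phi> \<and> emeasure \<phi> UNIV \<noteq> 0 \<and>
     (\<forall>A\<in>sets borel. emeasure \<phi> A > 0 \<longrightarrow> (\<forall>y. \<exists>n\<ge>1. emeasure (kernel_pow K n y) A > 0))"

text \<open>Note the argument order of the library: \<^const>\<open>absolutely_continuous\<close> \<open>\<psi> \<phi>\<close> means
  that \<open>\<phi>\<close> is dominated by \<open>\<psi>\<close>.\<close>

definition psi_irreducible :: "('a::topological_space \<Rightarrow> 'a measure) \<Rightarrow> 'a measure \<Rightarrow> bool" where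
  "psi_irreducible K \<psi> \<longleftrightarrow>
     irreducibility_measure K \<psi> \<and>
     (\<forall>\<phi>. irreducibility_measure K \<phi> \<longrightarrow> absolutely_continuous \<psi> \<phi>)"

definition kernel_cycle ::
    "('a::topological_space \<Rightarrow> 'a measure) \<Rightarrow> 'a measure \<Rightarrow> nat \<Rightarrow> (nat \<Rightarrow> 'a set) \<Rightarrow> bool" where
  "kernel_cycle K \<psi> k D \<longleftrightarrow>
     (\<forall>i<k. D i \<in> sets borel) \<and> disjoint_family_on D {..<k} \<and>
     (\<forall>i<k. \<forall>y\<in>D i. emeasure (K y) (D (Suc i mod k)) = 1) \<and>
     emeasure \<psi> (UNIV - (\<Union>i<k. D i)) = 0"

definition aperiodic :: "('a::topological_space \<Rightarrow> 'a measure) \<Rightarrow> 'a measure \<Rightarrow> bool" where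
  "aperiodic K \<psi> \<longleftrightarrow> \<not> (\<exists>k\<ge>2. \<exists>D. kernel_cycle K \<psi> k D)"

section \<open>Distance-like functions and the associated Wasserstein-like function\<close>

definition lower_semicontinuous :: "('a::topological_space \<Rightarrow> real) \<Rightarrow> bool" where
  "lower_semicontinuous g \<longleftrightarrow> (\<forall>a. open {x. a < g x})"

definition distance_like :: "('a::topological_space \<Rightarrow> 'a \<Rightarrow> real) \<Rightarrow> bool" where
  "distance_like d \<longleftrightarrow>
     (\<forall>x y. 0 \<le> d x y) \<and> (\<forall>x y. d x y = d y x) \<and> (\<forall>x y. d x y = 0 \<longleftrightarrow> x = y) \<and>
     lower_semicontinuous (\<lambda>p. d (fst p) (snd p))"

definition couplings :: "'a measure \<Rightarrow> 'a measure \<Rightarrow> ('a \<times> 'a) measure set" where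
  "couplings \<mu>1 \<mu>2 =
     {\<xi>. sets \<xi> = sets (\<mu>1 \<Otimes>\<^sub>M \<mu>2) \<and> distr \<xi> \<mu>1 fst = \<mu>1 \<and> distr \<xi> \<mu>2 snd = \<mu>2}"

text \<open>The infimum, the contraction coefficient and the eccentricity may be infinite, hence they take
  values in \<^typ>\<open>ennreal\<close>.\<close>

definition wasserstein :: "('a \<Rightarrow> 'a \<Rightarrow> real) \<Rightarrow> 'a measure \<Rightarrow> 'a measure \<Rightarrow> ennreal" where
  "wasserstein d \<mu>1 \<mu>2 = (INF \<xi>\<in>couplings \<mu>1 \<mu>2. \<integral>\<^sup>+ p. ennreal (d (fst p) (snd p)) \<partial>\<xi>)"

definition contraction_coeff :: "('a \<Rightarrow> 'a \<Rightarrow> real) \<Rightarrow> ('a \<Rightarrow> 'a measure) \<Rightarrow> ennreal" where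
  "contraction_coeff d K =
     (SUP (y1, y2)\<in>{(y1, y2). y1 \<noteq> y2}. wasserstein d (K y1) (K y2) / ennreal (d y1 y2))"

definition eccentricity :: "('a \<Rightarrow> 'a \<Rightarrow> real) \<Rightarrow> 'a measure \<Rightarrow> 'a \<Rightarrow> ennreal" where
  "eccentricity d \<mu> y = (\<integral>\<^sup>+ y'. ennreal (d y y') \<partial>\<mu>)"

definition lipschitz_wrt :: "('a \<Rightarrow> 'a \<Rightarrow> real) \<Rightarrow> real \<Rightarrow> ('a \<Rightarrow> real) \<Rightarrow> bool" where
  "lipschitz_wrt d L g \<longleftrightarrow> (\<forall>x y. \<bar>g x - g y\<bar> \<le> L * d x y)"

section \<open>Adaptive increasingly rare MCMC\<close>

text \<open>The spaces \<open>\<X>\<close> and \<open>\<Phi>\<close> are the types \<open>'x\<close> and \<open>'p\<close> with their Borel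
  \<open>\<sigma>\<close>-algebras; the Borel \<open>\<sigma>\<close>-algebra of \<open>'x \<times> 'p\<close> is the product one
  (\<open>borel_prod\<close>). The index space is the space of the measure \<open>I\<close>, whose values are irrelevant.\<close>

locale mcmc_family =
  fixes \<nu> :: "'x::polish_space measure"
    and I :: "'i measure"
    and \<pi> :: "'i \<Rightarrow> ('x \<times> 'p::polish_space) measure"
    and P :: "'i \<Rightarrow> 'x \<times> 'p \<Rightarrow> ('x \<times> 'p) measure"
  assumes nu_prob: "prob_space \<nu>" and nu_sets: "sets \<nu> = sets borel"
    and pi_prob: "\<gamma> \<in> space I \<Longrightarrow> prob_space (\<pi> \<gamma>)"
    and pi_sets: "\<gamma> \<in> space I \<Longrightarrow> sets (\<pi> \<gamma>) = sets borel"
    and P_kernel: "\<gamma> \<in> space I \<Longrightarrow> P \<gamma> \<in> borel \<rightarrow>\<^sub>M prob_algebra borel"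
    and pi_marginal:
      "\<gamma> \<in> space I \<Longrightarrow> B \<in> sets borel \<Longrightarrow> emeasure (\<pi> \<gamma>) (B \<times> UNIV) = emeasure \<nu> B"
    and pi_invariant: "\<gamma> \<in> space I \<Longrightarrow> \<pi> \<gamma> \<bind> P \<gamma> = \<pi> \<gamma>"
    and P_irreducible_aperiodic:
      "\<gamma> \<in> space I \<Longrightarrow> \<exists>\<psi>. psi_irreducible (P \<gamma>) \<psi> \<and> aperiodic (P \<gamma>) \<psi>"
    and P_jointly_measurable:
      "A \<in> sets borel \<Longrightarrow> (\<lambda>(y, \<gamma>). emeasure (P \<gamma> y) A) \<in> borel_measurable (borel \<Otimes>\<^sub>M I)"

definition air_time :: "real \<Rightarrow> nat \<Rightarrow> nat" where
  "air_time \<beta> m = (\<Sum>j=1..m. nat \<lceil>real j powr \<beta>\<rceil>)"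

definition history_algebra ::
    "'w measure \<Rightarrow> 'i measure \<Rightarrow> (nat \<Rightarrow> 'w \<Rightarrow> 'y::topological_space) \<Rightarrow> (nat \<Rightarrow> 'w \<Rightarrow> 'i) \<Rightarrow> nat \<Rightarrow> 'w measure" where
  "history_algebra M I Y \<Gamma> n = sigma (space M)
     (\<Union>i\<le>n. {Y i -` A \<inter> space M |A. A \<in> sets borel} \<union> {\<Gamma> i -` B \<inter> space M |B. B \<in> sets I})"

text \<open>\<open>M\<close> is the underlying probability space \<open>(\<Omega>, \<F>, \<bbbP>)\<close>.\<close>

locale air_mcmc = mcmc_family \<nu> I \<pi> P + prob_space M
  for \<nu> :: "'x::polish_space measure"
    and I :: "'i measure"
    and \<pi> :: "'i \<Rightarrow> ('x \<times> 'p::polish_space) measure"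
    and P :: "'i \<Rightarrow> 'x \<times> 'p \<Rightarrow> ('x \<times> 'p) measure"
    and M :: "'w measure" +
  fixes \<beta> :: real
    and Y :: "nat \<Rightarrow> 'w \<Rightarrow> 'x \<times> 'p"
    and \<Gamma> :: "nat \<Rightarrow> 'w \<Rightarrow> 'i"
    and y0 :: "'x \<times> 'p"
    and \<gamma>0 :: 'i
  assumes beta_pos: "\<beta> > 0"
    and Y_measurable: "Y n \<in> M \<rightarrow>\<^sub>M borel"
    and Gamma_measurable: "\<Gamma> n \<in> M \<rightarrow>\<^sub>M I"
    and gamma0: "\<gamma>0 \<in> space I"
    and Y_initial: "\<omega> \<in> space M \<Longrightarrow> Y 0 \<omega> = y0"
    and Gamma_initial: "\<omega> \<in> space M \<Longrightarrow> \<Gamma> 0 \<omega> = \<gamma>0"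
    and transition: "B \<in> sets borel \<Longrightarrow>
      AE \<omega> in M. real_cond_exp M (history_algebra M I Y \<Gamma> n)
        (indicator (Y (Suc n) -` B \<inter> space M)) \<omega> = measure (P (\<Gamma> n \<omega>) (Y n \<omega>)) B"
    and adaptation: "\<exists>U. U \<in> (\<Pi>\<^sub>M i\<in>{..n}. borel) \<Otimes>\<^sub>M (\<Pi>\<^sub>M i\<in>{..<n}. I) \<rightarrow>\<^sub>M I \<and>
      (\<forall>\<omega>\<in>space M. \<Gamma> n \<omega> = U ((\<lambda>i\<in>{..n}. Y i \<omega>), (\<lambda>i\<in>{..<n}. \<Gamma> i \<omega>)))"
    and increasingly_rare:
      "i1 \<in> {air_time \<beta> j..<air_time \<beta> (Suc j)} \<Longrightarrow> i2 \<in> {air_time \<beta> j..<air_time \<beta> (Suc j)} \<Longrightarrow>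
       \<omega> \<in> space M \<Longrightarrow> \<Gamma> i1 \<omega> = \<Gamma> i2 \<omega>"
    and pi_Gamma_measurable:
      "(g :: 'x \<times> 'p \<Rightarrow> real) \<in> borel_measurable borel \<Longrightarrow>
       (\<And>\<gamma>. \<gamma> \<in> space I \<Longrightarrow> integrable (\<pi> \<gamma>) g) \<Longrightarrow>
       (\<lambda>\<omega>. \<integral>y. g y \<partial>\<pi> (\<Gamma> n \<omega>)) \<in> borel_measurable M"

end

theory Submission
  imports Defs "HOL-Real_Asymp.Real_Asymp"
begin

text \<open>
  Acting on Lipschitz functions, a kernel with contraction coefficient \<open>t\<close> multiplies Lipschitz
  constants by at most \<open>t\<close>; this is the easy half of Kantorovich duality and needs neither a triangle
  inequality nor optimal couplings. Hence \<open>P\<^sub>\<gamma>\<^sup>n h\<close> converges to \<open>\<nu>(f)\<close> geometrically, uniformly in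
  the starting point and in \<open>\<gamma>\<close>, and the Poisson equation \<open>g\<^sub>\<gamma> - P\<^sub>\<gamma> g\<^sub>\<gamma> = h - \<nu>(f)\<close> has a solution
  bounded by a constant \<open>G\<close> independent of \<open>\<gamma>\<close>. Then \<open>h(Y\<^sub>i) - \<nu>(f)\<close> is the sum of
  \<open>g(Y\<^sub>i) - g(Y\<^sub>i\<^sub>+\<^sub>1)\<close> and the martingale difference \<open>g(Y\<^sub>i\<^sub>+\<^sub>1) - P g(Y\<^sub>i)\<close>, with \<open>g\<close> and \<open>P\<close> taken at
  \<open>\<Gamma>\<^sub>i\<close>. The former telescopes between adaptations, of which there are \<open>O(\<surd>n)\<close> up to time \<open>n\<close>
  because \<open>\<beta> \<ge> 1\<close>; the latter is handled by the Azuma inequality and the Borel-Cantelli lemma.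
\<close>

section \<open>Azuma's inequality and an almost sure growth rate for martingales with bounded
  increments\<close>

section \<open>Bounded martingale differences\<close>

text \<open>The expression \<open>- y + ln (1 + 1 / 2 * (exp (2 * y) - 1))\<close> is
  \<open>ln (cosh y)\<close>. The inequality behind Hoeffding's lemma, at width \<open>2 * y\<close>
  and weight \<open>1 / 2\<close>, bounds it by \<open>y^2 / 2\<close> for nonnegative
  \<open>y\<close>; evenness of cosh covers the rest.\<close>

lemma cosh_le_exp_half_square: "cosh x \<le> exp (x\<^sup>2 / 2)" for x :: real
proof -
  have nonneg: "cosh y \<le> exp (y\<^sup>2 / 2)" if "y \<ge> 0" for y :: real
  proof -
    have pos: "1 + 1 / 2 * (exp (2 * y) - 1) > 0"
      using exp_gt_zero[of "2 * y"] by (simp add: field_simps add_pos_pos)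
    have "- y + ln (1 + 1 / 2 * (exp (2 * y) - 1)) \<le> y\<^sup>2 / 2"
      using Hoeffdings_lemma_aux[of "2 * y" "1 / 2"] that by simp
    then have "exp (- y + ln (1 + 1 / 2 * (exp (2 * y) - 1))) \<le> exp (y\<^sup>2 / 2)"
      by (rule iffD2[OF exp_le_cancel_iff])
    also have "exp (- y + ln (1 + 1 / 2 * (exp (2 * y) - 1))) = exp (- y) * (1 + 1 / 2 * (exp (2 * y) - 1))"
      using pos by (simp only: exp_add exp_ln)
    also have "\<dots> = cosh y"
    proof -
      have "inverse e * (1 + 1 / 2 * (e\<^sup>2 - 1)) = (e + inverse e) / 2" if "e > 0" for e :: real
        using that by (simp add: field_simps power2_eq_square)
      then show ?thesis
        unfolding cosh_field_def exp_minus exp_double by simp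
    qed
    finally show ?thesis .
  qed
  show ?thesis
    using nonneg[of x] nonneg[of "- x"] by (cases "x \<ge> 0") auto
qed

text \<open>By convexity, \<open>exp (s * x)\<close> lies below its chord over
  \<open>[- B, B]\<close>. The chord is written as a constant plus a multiple of \<open>x\<close>
  because the linear term disappears when \<open>x\<close> is a martingale difference.\<close>

lemma exp_le_chord:
  fixes x B s :: real
  assumes "B > 0" "\<bar>x\<bar> \<le> B"
  shows "exp (s * x) \<le> cosh (s * B) + x * (sinh (s * B) / B)"
proof -
  \<comment> \<open>The weight for which \<open>x = (1 - t) * - B + t * B\<close>.\<close>
  define t where "t = (1 + x / B) / 2"
  have t: "0 \<le> t" "t \<le> 1"
    using assms by (auto simp: t_def field_simps)
  have "convex_on UNIV (exp :: real \<Rightarrow> real)"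
    using convex_on_exp[of 1] by simp
  from convex_onD[OF this t, of "- (s * B)" "s * B"]
  have "exp ((1 - t) * - (s * B) + t * (s * B)) \<le> (1 - t) * exp (- (s * B)) + t * exp (s * B)"
    by simp
  also have "(1 - t) * - (s * B) + t * (s * B) = s * x"
    using assms by (simp add: t_def field_simps)
  also have "(1 - t) * exp (- (s * B)) + t * exp (s * B) = cosh (s * B) + x * (sinh (s * B) / B)"
    using assms by (simp add: t_def cosh_def sinh_def field_simps)
  finally show ?thesis .
qed

text \<open>The surplus factor \<open>ln n powr \<epsilon>\<close> eventually exceeds
  \<open>2 / c\<close>, and from then on the terms are at most \<open>1 / n^2\<close>. Without it
  they would be \<open>n powr - c\<close>, summable only for \<open>c > 1\<close>.\<close>

lemma summable_exp_ln_powr: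
  fixes c \<epsilon> :: real
  assumes "c > 0" "\<epsilon> > 0"
  shows "summable (\<lambda>n. exp (- (c * ln (real n) powr (1 + \<epsilon>))))"
proof (rule summable_comparison_test_ev)
  have "filterlim (\<lambda>n. ln (real n) powr \<epsilon>) at_top sequentially"
    using assms by real_asymp
  then have "\<forall>\<^sub>F n in sequentially. ln (real n) powr \<epsilon> \<ge> 2 / c"
    by (simp add: filterlim_at_top)
  then show "\<forall>\<^sub>F n in sequentially.
      norm (exp (- (c * ln (real n) powr (1 + \<epsilon>)))) \<le> 1 / real n ^ 2"
    using eventually_ge_at_top[of 2]
  proof eventually_elim
    case (elim n)
    have ln: "ln (real n) > 0"
      using elim by simp
    have "2 * ln (real n) \<le> (c * ln (real n) powr \<epsilon>) * ln (real n)"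
      using elim ln assms by (intro mult_right_mono) (auto simp: field_simps)
    also have "\<dots> = c * ln (real n) powr (1 + \<epsilon>)"
      using ln by (simp add: powr_add)
    finally have "exp (- (c * ln (real n) powr (1 + \<epsilon>))) \<le> exp (- (2 * ln (real n)))"
      by simp
    also have "\<dots> = 1 / real n ^ 2"
      using elim by (simp add: exp_minus exp_of_nat_mult[of 2, simplified] field_simps)
    finally show ?case by simp
  qed
  show "summable (\<lambda>n. 1 / real n ^ 2)"
    using inverse_power_summable[of 2] by (simp add: field_simps)
qed

locale bounded_martingale_differences = prob_space M for M :: "'w measure" +
  fixes F :: "nat \<Rightarrow> 'w measure" and D :: "nat \<Rightarrow> 'w \<Rightarrow> real" and B :: real
  assumes subalg: "subalgebra M (F i)"
    and filtration: "sets (F i) \<subseteq> sets (F (Suc i))"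
    and D_measurable: "D i \<in> borel_measurable (F (Suc i))"
    and B_pos: "B > 0"
    and D_bounded: "\<omega> \<in> space M \<Longrightarrow> \<bar>D i \<omega>\<bar> \<le> B"
    and D_cond_exp: "AE \<omega> in M. real_cond_exp M (F i) (D i) \<omega> = 0"
begin

lemma D_borel[measurable]: "D i \<in> borel_measurable M"
  using measurable_from_subalg[OF subalg D_measurable] .

lemma sum_D_measurable: "(\<lambda>\<omega>. \<Sum>i<n. D i \<omega>) \<in> borel_measurable (F n)"
proof -
  have "D i \<in> borel_measurable (F n)" if "i < n" for i
  proof -
    have "sets (F (Suc i)) \<subseteq> sets (F n)"
      using lift_Suc_mono_le[of "\<lambda>i. sets (F i)", OF filtration] that by simp
    then have "subalgebra (F n) (F (Suc i))"
      using subalg[of n] subalg[of "Suc i"] by (simp add: subalgebra_def)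
    then show ?thesis
      using measurable_from_subalg D_measurable by blast
  qed
  then show ?thesis by (intro borel_measurable_sum) auto
qed

lemma sum_D_bounded: "\<omega> \<in> space M \<Longrightarrow> \<bar>\<Sum>i<n. D i \<omega>\<bar> \<le> real n * B"
  using sum_bounded_above[of "{..<n}" "\<lambda>i. \<bar>D i \<omega>\<bar>" B] D_bounded
  by (intro order_trans[OF sum_abs]) auto

lemma integrable_exp_sum_D: "integrable M (\<lambda>\<omega>. exp (s * (\<Sum>i<n. D i \<omega>)))"
proof (rule integrable_const_bound[where B = "exp (\<bar>s\<bar> * (real n * B))"])
  have "s * (\<Sum>i<n. D i \<omega>) \<le> \<bar>s\<bar> * (real n * B)" if "\<omega> \<in> space M" for \<omega>
    using mult_left_mono[OF sum_D_bounded[OF that, of n], of "\<bar>s\<bar>"]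
    by (simp flip: abs_mult)
  then show "AE \<omega> in M. norm (exp (s * (\<Sum>i<n. D i \<omega>))) \<le> exp (\<bar>s\<bar> * (real n * B))"
    by simp
qed measurable

text \<open>Azuma's exponential moment bound. Given \<open>F n\<close>, the chord bound for
  \<open>exp (s * D n)\<close> loses its linear term, so each step multiplies the moment by at most
  \<open>cosh (s * B)\<close>, hence by at most \<open>exp ((s * B)^2 / 2)\<close>.\<close>

lemma expectation_exp_sum_D:
  "expectation (\<lambda>\<omega>. exp (s * (\<Sum>i<n. D i \<omega>))) \<le> exp (real n * (s * B)\<^sup>2 / 2)"
proof (induction n)
  case 0
  then show ?case by (simp add: prob_space)
next
  case (Suc n)
  define W where "W \<omega> = exp (s * (\<Sum>i<n. D i \<omega>))" for \<omega>
  have W_F: "W \<in> borel_measurable (F n)"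
    unfolding W_def using sum_D_measurable by measurable
  have W_M[measurable]: "W \<in> borel_measurable M"
    unfolding W_def by measurable
  have W: "integrable M W"
    unfolding W_def by (rule integrable_exp_sum_D)
  have WD: "integrable M (\<lambda>\<omega>. W \<omega> * D n \<omega>)"
  proof (rule Bochner_Integration.integrable_bound[OF integrable_mult_left[OF W, of B]])
    show "AE \<omega> in M. norm (W \<omega> * D n \<omega>) \<le> norm (W \<omega> * B)"
      using D_bounded B_pos by (auto simp: abs_mult intro!: mult_left_mono)
  qed measurable
  interpret finite_measure_subalgebra M "F n"
    by unfold_locales (rule subalg)
  \<comment> \<open>\<open>W\<close> is already known at time \<open>n\<close>, so
    \<open>D n\<close> may be replaced by its conditional expectation, which vanishes.\<close>
  have "expectation (\<lambda>\<omega>. W \<omega> * D n \<omega>) = expectation (\<lambda>\<omega>. W \<omega> * real_cond_exp M (F n) (D n) \<omega>)"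
    by (rule real_cond_exp_intg(2)[symmetric]) (use WD W_F in auto)
  also have "\<dots> = expectation (\<lambda>_. 0)"
    using D_cond_exp[of n] by (intro integral_cong_AE) (auto intro: borel_measurable_cond_exp2)
  finally have WD_0: "expectation (\<lambda>\<omega>. W \<omega> * D n \<omega>) = 0"
    by simp
  have "expectation (\<lambda>\<omega>. exp (s * (\<Sum>i<Suc n. D i \<omega>))) = expectation (\<lambda>\<omega>. W \<omega> * exp (s * D n \<omega>))"
    by (simp add: W_def algebra_simps exp_add)
  also have "\<dots> \<le> expectation (\<lambda>\<omega>. cosh (s * B) * W \<omega> + sinh (s * B) / B * (W \<omega> * D n \<omega>))"
  proof (rule integral_mono)
    show "integrable M (\<lambda>\<omega>. W \<omega> * exp (s * D n \<omega>))"
      using integrable_exp_sum_D[of s "Suc n"] by (simp add: W_def algebra_simps exp_add)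
    show "integrable M (\<lambda>\<omega>. cosh (s * B) * W \<omega> + sinh (s * B) / B * (W \<omega> * D n \<omega>))"
      using W WD by simp
    show "W \<omega> * exp (s * D n \<omega>) \<le> cosh (s * B) * W \<omega> + sinh (s * B) / B * (W \<omega> * D n \<omega>)"
      if "\<omega> \<in> space M" for \<omega>
      using mult_left_mono[OF exp_le_chord[OF B_pos D_bounded[OF that, of n], of s], of "W \<omega>"]
      by (simp add: W_def algebra_simps)
  qed
  also have "\<dots> = cosh (s * B) * expectation W"
    using W WD WD_0 by simp
  also have "\<dots> \<le> exp ((s * B)\<^sup>2 / 2) * exp (real n * (s * B)\<^sup>2 / 2)"
    using Suc.IH by (intro mult_mono cosh_le_exp_half_square) (auto simp: W_def[abs_def])
  also have "\<dots> = exp (real (Suc n) * (s * B)\<^sup>2 / 2)"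
    by (simp add: add_divide_distrib distrib_right flip: exp_add)
  finally show ?case .
qed

text \<open>Symmetry under negation turns the upper tail bound into a two-sided one.\<close>

lemma bounded_martingale_differences_uminus: "bounded_martingale_differences M F (\<lambda>i \<omega>. - D i \<omega>) B"
proof unfold_locales
  fix i
  interpret finite_measure_subalgebra M "F i"
    by unfold_locales (rule subalg)
  have "integrable M (D i)"
    by (rule integrable_const_bound[where B = B]) (use D_bounded in auto)
  from real_cond_exp_cmult[OF this, of "- 1"]
  show "AE \<omega> in M. real_cond_exp M (F i) (\<lambda>\<omega>. - D i \<omega>) \<omega> = 0"
    using D_cond_exp[of i] by auto
qed (use subalg filtration D_measurable B_pos D_bounded in auto)

lemma prob_sum_D_ge:
  assumes "t \<ge> 0" "n > 0"
  shows "prob {\<omega>\<in>space M. (\<Sum>i<n. D i \<omega>) \<ge> t} \<le> exp (- t\<^sup>2 / (2 * real n * B\<^sup>2))"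
proof -
  \<comment> \<open>The value of \<open>s\<close> that minimises the Chernoff exponent
    \<open>n * (s * B)^2 / 2 - s * t\<close>.\<close>
  define s where "s = t / (real n * B\<^sup>2)"
  have "s \<ge> 0"
    using assms by (simp add: s_def)
  then have "{\<omega>\<in>space M. (\<Sum>i<n. D i \<omega>) \<ge> t}
      \<subseteq> {\<omega>\<in>space M. exp (s * (\<Sum>i<n. D i \<omega>)) \<ge> exp (s * t)}"
    by (auto intro: mult_left_mono)
  then have "prob {\<omega>\<in>space M. (\<Sum>i<n. D i \<omega>) \<ge> t}
      \<le> prob {\<omega>\<in>space M. exp (s * (\<Sum>i<n. D i \<omega>)) \<ge> exp (s * t)}"
    by (intro finite_measure_mono) auto
  also have "\<dots> \<le> expectation (\<lambda>\<omega>. exp (s * (\<Sum>i<n. D i \<omega>))) / exp (s * t)"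
    by (rule integral_Markov_inequality_measure[where A = "{}"]) (auto intro: integrable_exp_sum_D)
  also have "\<dots> \<le> exp (real n * (s * B)\<^sup>2 / 2) / exp (s * t)"
    by (intro divide_right_mono expectation_exp_sum_D) simp
  also have "\<dots> = exp (- t\<^sup>2 / (2 * real n * B\<^sup>2))"
    using assms B_pos by (simp add: s_def field_simps power2_eq_square flip: exp_diff)
  finally show ?thesis .
qed

lemma prob_abs_sum_D_ge:
  assumes "t \<ge> 0" "n > 0"
  shows "prob {\<omega>\<in>space M. \<bar>\<Sum>i<n. D i \<omega>\<bar> \<ge> t} \<le> 2 * exp (- t\<^sup>2 / (2 * real n * B\<^sup>2))"
proof -
  interpret neg: bounded_martingale_differences M F "\<lambda>i \<omega>. - D i \<omega>" B
    by (rule bounded_martingale_differences_uminus)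
  have "prob {\<omega>\<in>space M. \<bar>\<Sum>i<n. D i \<omega>\<bar> \<ge> t}
      \<le> prob ({\<omega>\<in>space M. (\<Sum>i<n. D i \<omega>) \<ge> t} \<union> {\<omega>\<in>space M. (\<Sum>i<n. - D i \<omega>) \<ge> t})"
    by (intro finite_measure_mono) (auto simp: sum_negf abs_if split: if_splits)
  also have "\<dots> \<le> prob {\<omega>\<in>space M. (\<Sum>i<n. D i \<omega>) \<ge> t} + prob {\<omega>\<in>space M. (\<Sum>i<n. - D i \<omega>) \<ge> t}"
    by (intro measure_Un_le) auto
  also have "\<dots> \<le> 2 * exp (- t\<^sup>2 / (2 * real n * B\<^sup>2))"
    using prob_sum_D_ge[OF assms] neg.prob_sum_D_ge[OF assms] by simp
  finally show ?thesis .
qed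

text \<open>At level \<open>\<delta> * a n\<close> the factor \<open>sqrt n\<close> in
  \<open>a n\<close>, once squared, cancels the \<open>n\<close> in the denominator of Azuma's
  exponent. What remains is a multiple of \<open>ln n powr (1 + 2 * \<epsilon>)\<close>, so the
  tails are summable and Borel-Cantelli applies for each \<open>\<delta>\<close>.\<close>

theorem strong_law:
  assumes "\<epsilon> > 0"
  shows "AE \<omega> in M.
    (\<lambda>n. (\<Sum>i<n. D i \<omega>) / (sqrt (real n) * ln (real n) powr (1/2 + \<epsilon>))) \<longlonglongrightarrow> 0"
proof -
  define a where "a n = sqrt (real n) * ln (real n) powr (1/2 + \<epsilon>)" for n
  have a_nonneg: "a n \<ge> 0" for n
    by (simp add: a_def)
  have "AE \<omega> in M. \<forall>\<^sub>F n in sequentially. \<bar>\<Sum>i<n. D i \<omega>\<bar> < \<delta> * a n" if "\<delta> > 0" for \<delta> :: real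
  proof -
    define E where "E n = {\<omega>\<in>space M. \<bar>\<Sum>i<n. D i \<omega>\<bar> \<ge> \<delta> * a n}" for n
    define c where "c = \<delta>\<^sup>2 / (2 * B\<^sup>2)"
    have "c > 0"
      using that B_pos by (simp add: c_def)
    have "AE \<omega> in M. \<forall>\<^sub>F n in sequentially. \<omega> \<in> space M - E n"
    proof (rule borel_cantelli_AE1)
      show "E n \<in> sets M" for n
        unfolding E_def by measurable
      show "summable (\<lambda>n. prob (E n))"
      proof (rule summable_comparison_test_ev)
        show "\<forall>\<^sub>F n in sequentially.
            norm (prob (E n)) \<le> 2 * exp (- (c * ln (real n) powr (1 + 2 * \<epsilon>)))"
          using eventually_ge_at_top[of 1]
        proof eventually_elim
          case (elim n)
          have "(ln (real n) powr (1/2 + \<epsilon>))\<^sup>2 = ln (real n) powr (1 + 2 * \<epsilon>)"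
            by (simp add: power2_eq_square flip: powr_add)
          then have "(\<delta> * a n)\<^sup>2 / (2 * real n * B\<^sup>2) = c * ln (real n) powr (1 + 2 * \<epsilon>)"
            using elim by (simp add: a_def c_def power_mult_distrib)
          then show ?case
            using prob_abs_sum_D_ge[of "\<delta> * a n" n] elim that a_nonneg by (simp add: E_def)
        qed
        show "summable (\<lambda>n. 2 * exp (- (c * ln (real n) powr (1 + 2 * \<epsilon>))))"
          using \<open>c > 0\<close> assms by (intro summable_mult summable_exp_ln_powr) auto
      qed
    qed (simp add: less_top[symmetric])
    then show ?thesis
      by eventually_elim (auto simp: E_def elim: eventually_mono)
  qed
  \<comment> \<open>The countably many tolerances \<open>1 / (k + 1)\<close> suffice, so a single
    null set serves all of them.\<close>
  then have "AE \<omega> in M. \<forall>k. \<forall>\<^sub>F n in sequentially. \<bar>\<Sum>i<n. D i \<omega>\<bar> < inverse (real (Suc k)) * a n"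
    by (subst AE_all_countable) auto
  then show ?thesis
  proof eventually_elim
    case (elim \<omega>)
    show ?case
    proof (rule tendstoI)
      fix e :: real assume "e > 0"
      then obtain k where k: "inverse (real (Suc k)) < e"
        using reals_Archimedean by blast
      show "\<forall>\<^sub>F n in sequentially.
          dist ((\<Sum>i<n. D i \<omega>) / (sqrt (real n) * ln (real n) powr (1/2 + \<epsilon>))) 0 < e"
        using elim[rule_format, of k]
      proof eventually_elim
        case (elim n)
        \<comment> \<open>If \<open>a n\<close> were 0, the strict bound would make an absolute
          value negative; hence the division below is legitimate.\<close>
        with a_nonneg[of n] have "a n > 0"
          by (cases "a n = 0") auto
        then have "\<bar>\<Sum>i<n. D i \<omega>\<bar> / a n < inverse (real (Suc k))"
          using elim by (simp add: pos_divide_less_eq)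
        then show ?case
          using k \<open>a n > 0\<close> by (simp add: a_def[symmetric])
      qed
    qed
  qed
qed

end

section \<open>The easy half of Kantorovich duality for distance-like costs\<close>

section \<open>Contraction of Lipschitz functions\<close>

text \<open>Lower semicontinuity makes the superlevel sets open, and second countability identifies
  the Borel sets of the square with the product sigma-algebra.\<close>

lemma distance_like_borel_measurable:
  fixes d :: "'a::second_countable_topology \<Rightarrow> 'a \<Rightarrow> real"
  assumes "distance_like d"
  shows "(\<lambda>p. d (fst p) (snd p)) \<in> borel_measurable (borel \<Otimes>\<^sub>M borel)"
  using assms unfolding borel_prod distance_like_def lower_semicontinuous_def
  by (intro borel_measurable_iff_greater[THEN iffD2]) auto

lemma distance_like_borel_measurable':
  fixes d :: "'a::second_countable_topology \<Rightarrow> 'a \<Rightarrow> real"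
  assumes "distance_like d"
  shows "d y \<in> borel_measurable borel"
  using measurable_compose[OF measurable_Pair1'[of y] distance_like_borel_measurable[OF assms]]
  by simp

lemma integrable_bounded_prob:
  fixes g :: "'a \<Rightarrow> real"
  assumes "prob_space \<mu>" "g \<in> borel_measurable \<mu>" "\<And>x. \<bar>g x\<bar> \<le> B"
  shows "integrable \<mu> g"
proof -
  interpret prob_space \<mu> by fact
  show ?thesis
    by (rule integrable_const_bound[where B = B]) (use assms in auto)
qed

lemma abs_integral_le_prob:
  fixes g :: "'a \<Rightarrow> real"
  assumes "prob_space \<mu>" "\<And>x. x \<in> space \<mu> \<Longrightarrow> \<bar>g x\<bar> \<le> B" "B \<ge> 0"
  shows "\<bar>\<integral>x. g x \<partial>\<mu>\<bar> \<le> B"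
proof -
  interpret prob_space \<mu> by fact
  show ?thesis
  proof (cases "integrable \<mu> g")
    case True
    have "\<bar>\<integral>x. g x \<partial>\<mu>\<bar> \<le> (\<integral>x. \<bar>g x\<bar> \<partial>\<mu>)"
      by (rule integral_abs_bound)
    also have "\<dots> \<le> B"
      using True assms by (intro integral_le_const) auto
    finally show ?thesis .
  \<comment> \<open>A non-integrable function has integral 0 by convention, which
    \<open>B \<ge> 0\<close> covers.\<close>
  qed (use assms in \<open>simp add: not_integrable_integral_eq\<close>)
qed

text \<open>Couplings are described by their marginals alone; total mass 1 is read off the first
  marginal.\<close>

lemma prob_space_coupling:
  assumes "prob_space \<mu>1" "\<xi> \<in> couplings \<mu>1 \<mu>2"
  shows "prob_space \<xi>"
proof -
  have "emeasure \<xi> (space \<xi>) = emeasure (distr \<xi> \<mu>1 fst) (space \<mu>1)"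
    using assms sets_eq_imp_space_eq[of \<xi> "\<mu>1 \<Otimes>\<^sub>M \<mu>2"]
    by (subst emeasure_distr) (auto simp: couplings_def space_pair_measure
        intro!: arg_cong[where f = "emeasure \<xi>"] measurable_fst cong: measurable_cong_sets)
  also have "\<dots> = 1"
    using assms by (simp add: couplings_def prob_space.emeasure_space_1)
  finally show ?thesis
    by (rule prob_spaceI)
qed

text \<open>For each single coupling the difference of the integrals is the integral of
  \<open>g (fst p) - g (snd p)\<close>, at most \<open>c\<close> times the transport cost. Since
  this holds for every coupling, it passes to the infimum without an optimal one.\<close>

lemma integral_diff_le_wasserstein:
  fixes g :: "'a::second_countable_topology \<Rightarrow> real"
  assumes d: "distance_like d"
    and prob: "prob_space \<mu>1" "prob_space \<mu>2"
    and sets: "sets \<mu>1 = sets borel" "sets \<mu>2 = sets borel"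
    and g[measurable]: "g \<in> borel_measurable borel"
    and bounded: "\<And>x. \<bar>g x\<bar> \<le> B"
    and lip: "lipschitz_wrt d c g" and c: "c > 0"
  shows "ennreal (\<bar>(\<integral>x. g x \<partial>\<mu>1) - (\<integral>x. g x \<partial>\<mu>2)\<bar> / c) \<le> wasserstein d \<mu>1 \<mu>2"
  unfolding wasserstein_def
proof (rule INF_greatest)
  fix \<xi> assume \<xi>: "\<xi> \<in> couplings \<mu>1 \<mu>2"
  have sets_\<xi>[measurable_cong]: "sets \<xi> = sets (borel \<Otimes>\<^sub>M borel)"
    using \<xi> by (simp add: couplings_def sets cong: sets_pair_measure_cong)
  interpret \<xi>: prob_space \<xi>
    by (rule prob_space_coupling) fact+
  have marginals: "\<mu>1 = distr \<xi> borel fst" "\<mu>2 = distr \<xi> borel snd"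
    using \<xi> sets by (auto simp: couplings_def cong: distr_cong)
  have int: "integrable \<xi> (\<lambda>p. g (fst p))" "integrable \<xi> (\<lambda>p. g (snd p))"
    by (auto intro!: integrable_bounded_prob[where B = B] \<xi>.prob_space_axioms bounded)
  have "\<bar>(\<integral>x. g x \<partial>\<mu>1) - (\<integral>x. g x \<partial>\<mu>2)\<bar> = \<bar>\<integral>p. g (fst p) - g (snd p) \<partial>\<xi>\<bar>"
    unfolding marginals by (simp add: integral_distr int)
  also have "ennreal \<dots> \<le> (\<integral>\<^sup>+ p. ennreal \<bar>g (fst p) - g (snd p)\<bar> \<partial>\<xi>)"
    using integral_norm_bound_ennreal[of \<xi> "\<lambda>p. g (fst p) - g (snd p)"] int by simp
  also have "\<dots> \<le> (\<integral>\<^sup>+ p. ennreal c * ennreal (d (fst p) (snd p)) \<partial>\<xi>)"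
    using lip c by (intro nn_integral_mono) (auto simp: lipschitz_wrt_def simp flip: ennreal_mult' intro!: ennreal_leI)
  also have "\<dots> = ennreal c * (\<integral>\<^sup>+ p. ennreal (d (fst p) (snd p)) \<partial>\<xi>)"
    using distance_like_borel_measurable[OF d] by (intro nn_integral_cmult) measurable
  finally show "ennreal (\<bar>(\<integral>x. g x \<partial>\<mu>1) - (\<integral>x. g x \<partial>\<mu>2)\<bar> / c) \<le> (\<integral>\<^sup>+ p. ennreal (d (fst p) (snd p)) \<partial>\<xi>)"
    using c by (simp add: divide_ennreal[symmetric] divide_le_posI_ennreal mult.commute)
qed

text \<open>Duality bounds the left side by \<open>c\<close> times the Wasserstein-like function of
  \<open>\<kappa> x\<close> and \<open>\<kappa> y\<close>, and the contraction coefficient bounds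
  that by \<open>t * d x y\<close>. The supremum in the coefficient omits the diagonal, where both
  sides are 0.\<close>

lemma lipschitz_wrt_integral_kernel:
  fixes g :: "'a::second_countable_topology \<Rightarrow> real"
  assumes d: "distance_like d"
    and \<kappa>: "\<kappa> \<in> borel \<rightarrow>\<^sub>M prob_algebra borel"
    and contr: "contraction_coeff d \<kappa> \<le> ennreal t" and t: "t \<ge> 0"
    and g: "g \<in> borel_measurable borel"
    and bounded: "\<And>x. \<bar>g x\<bar> \<le> B"
    and lip: "lipschitz_wrt d c g" and c: "c > 0"
  shows "lipschitz_wrt d (t * c) (\<lambda>y. \<integral>x. g x \<partial>\<kappa> y)"
  unfolding lipschitz_wrt_def
proof (intro allI)
  fix x y
  have \<kappa>': "prob_space (\<kappa> z)" "sets (\<kappa> z) = sets borel" for z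
    using measurable_space[OF \<kappa>, of z] by (auto simp: space_prob_algebra)
  show "\<bar>(\<integral>z. g z \<partial>\<kappa> x) - (\<integral>z. g z \<partial>\<kappa> y)\<bar> \<le> t * c * d x y"
  proof (cases "x = y")
    case True
    then show ?thesis
      using d t c by (simp add: distance_like_def)
  next
    case False
    then have dxy: "d x y > 0"
      using d by (metis distance_like_def order_less_le)
    have "ennreal (\<bar>(\<integral>z. g z \<partial>\<kappa> x) - (\<integral>z. g z \<partial>\<kappa> y)\<bar> / c) / ennreal (d x y)
        \<le> wasserstein d (\<kappa> x) (\<kappa> y) / ennreal (d x y)"
      by (intro divide_right_mono_ennreal integral_diff_le_wasserstein[OF d \<kappa>'(1) \<kappa>'(1) \<kappa>'(2) \<kappa>'(2) g bounded lip c])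
    also have "\<dots> \<le> contraction_coeff d \<kappa>"
      unfolding contraction_coeff_def using False by (intro SUP_upper2[of "(x, y)"]) auto
    also note contr
    finally show ?thesis
      using dxy c t by (simp add: divide_ennreal field_simps)
  qed
qed

text \<open>This is the duality bound for the product coupling of a point mass at \<open>y\<close>
  with \<open>\<mu>\<close>, whose transport cost is the eccentricity; it is computed directly as an
  integral over \<open>\<mu>\<close>.\<close>

lemma integral_diff_le_eccentricity:
  fixes g :: "'a::second_countable_topology \<Rightarrow> real"
  assumes d: "distance_like d"
    and prob: "prob_space \<mu>" and sets: "sets \<mu> = sets borel"
    and g: "g \<in> borel_measurable borel"
    and bounded: "\<And>x. \<bar>g x\<bar> \<le> B"
    and lip: "lipschitz_wrt d c g" and c: "c > 0"
    and ecc: "eccentricity d \<mu> y \<le> ennreal K" and K: "K \<ge> 0"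
  shows "\<bar>g y - (\<integral>x. g x \<partial>\<mu>)\<bar> \<le> c * K"
proof -
  interpret prob_space \<mu> by fact
  note [measurable_cong] = sets
  note [measurable] = g
  have int: "integrable \<mu> g"
    by (rule integrable_bounded_prob[OF prob _ bounded]) measurable
  have "\<bar>g y - (\<integral>x. g x \<partial>\<mu>)\<bar> = \<bar>\<integral>x. g y - g x \<partial>\<mu>\<bar>"
    using int by (simp add: prob_space)
  also have "ennreal \<dots> \<le> (\<integral>\<^sup>+ x. ennreal \<bar>g y - g x\<bar> \<partial>\<mu>)"
    using integral_norm_bound_ennreal[of \<mu> "\<lambda>x. g y - g x"] int by simp
  also have "\<dots> \<le> (\<integral>\<^sup>+ x. ennreal c * ennreal (d y x) \<partial>\<mu>)"
    using lip c by (intro nn_integral_mono) (auto simp: lipschitz_wrt_def simp flip: ennreal_mult' intro!: ennreal_leI)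
  also have "\<dots> = ennreal c * eccentricity d \<mu> y"
    unfolding eccentricity_def
    using distance_like_borel_measurable'[OF d] by (intro nn_integral_cmult) measurable
  also have "\<dots> \<le> ennreal (c * K)"
    using ecc c K by (simp add: ennreal_mult mult_left_mono)
  finally show ?thesis
    using c K by simp
qed

section \<open>Iterated kernels: measurability, composition and invariance\<close>

section \<open>Powers of a kernel\<close>

lemma integral_bind_prob:
  fixes g :: "'b \<Rightarrow> real"
  assumes "prob_space \<mu>" "N \<in> \<mu> \<rightarrow>\<^sub>M prob_algebra R" "g \<in> borel_measurable R" "\<And>x. x \<in> space R \<Longrightarrow> \<bar>g x\<bar> \<le> B"
  shows "(\<integral>x. g x \<partial>(\<mu> \<bind> N)) = (\<integral>y. \<integral>x. g x \<partial>N y \<partial>\<mu>)"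
proof (rule integral_bind[where K = R and B = B and B' = 1])
  interpret prob_space \<mu> by fact
  show "finite_measure \<mu>"
    by (rule finite_measure_axioms)
  show "N \<in> \<mu> \<rightarrow>\<^sub>M subprob_algebra R"
    using assms by (rule_tac measurable_prob_algebraD)
  show "AE x in \<mu>. emeasure (N x) (space (N x)) \<le> ennreal 1"
    using measurable_space[OF assms(2)]
    by (auto simp: space_prob_algebra prob_space.emeasure_space_1)
qed (use assms in auto)

context
  fixes \<kappa> :: "'a::topological_space \<Rightarrow> 'a measure"
  assumes \<kappa>[measurable]: "\<kappa> \<in> borel \<rightarrow>\<^sub>M prob_algebra borel"
begin

lemma kernel_pow_measurable[measurable]: "kernel_pow \<kappa> n \<in> borel \<rightarrow>\<^sub>M prob_algebra borel"
proof (induction n)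
  case 0
  have "(return borel :: 'a \<Rightarrow> _) \<in> borel \<rightarrow>\<^sub>M prob_algebra borel"
    by measurable
  then show ?case by (simp cong: measurable_cong)
next
  case (Suc n)
  note [measurable] = Suc
  have "(\<lambda>y. \<kappa> y \<bind> kernel_pow \<kappa> n) \<in> borel \<rightarrow>\<^sub>M prob_algebra borel"
    by measurable
  then show ?case by (simp cong: measurable_cong)
qed

lemma prob_space_kernel_pow: "prob_space (kernel_pow \<kappa> n y)"
  and sets_kernel_pow: "sets (kernel_pow \<kappa> n y) = sets borel"
  using measurable_space[OF kernel_pow_measurable, of y] by (auto simp: space_prob_algebra)

text \<open>The Chapman-Kolmogorov equation, from associativity of the bind of measures.\<close>

lemma kernel_pow_add: "kernel_pow \<kappa> (m + n) y = kernel_pow \<kappa> m y \<bind> kernel_pow \<kappa> n"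
proof (induction m arbitrary: y)
  case 0
  then show ?case
    by (simp add: bind_return[where N = borel, OF measurable_prob_algebraD[OF kernel_pow_measurable]])
next
  case (Suc m)
  have "kernel_pow \<kappa> (Suc m) y \<bind> kernel_pow \<kappa> n = \<kappa> y \<bind> (\<lambda>x. kernel_pow \<kappa> m x \<bind> kernel_pow \<kappa> n)"
    using measurable_space[OF \<kappa>, of y]
    by (simp, intro bind_assoc[where N = borel and R = borel])
       (auto simp: space_prob_algebra intro!: measurable_prob_algebraD cong: measurable_cong_sets)
  moreover have "kernel_pow \<kappa> (m + n) = (\<lambda>x. kernel_pow \<kappa> m x \<bind> kernel_pow \<kappa> n)"
    using Suc by auto
  ultimately show ?case
    by simp
qed

lemma integral_kernel_pow_add:
  fixes g :: "'a \<Rightarrow> real"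
  assumes "g \<in> borel_measurable borel" "\<And>x. \<bar>g x\<bar> \<le> B"
  shows "(\<integral>x. g x \<partial>kernel_pow \<kappa> (m + n) y) = (\<integral>z. \<integral>x. g x \<partial>kernel_pow \<kappa> n z \<partial>kernel_pow \<kappa> m y)"
  unfolding kernel_pow_add
  by (rule integral_bind_prob[OF prob_space_kernel_pow _ assms])
     (simp add: sets_kernel_pow cong: measurable_cong_sets)

lemma integral_kernel_pow_Suc:
  fixes g :: "'a \<Rightarrow> real"
  assumes "g \<in> borel_measurable borel" "\<And>x. \<bar>g x\<bar> \<le> B"
  shows "(\<integral>x. g x \<partial>kernel_pow \<kappa> (Suc n) y) = (\<integral>z. \<integral>x. g x \<partial>kernel_pow \<kappa> n z \<partial>\<kappa> y)"
  using measurable_space[OF \<kappa>, of y]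
  by (simp, intro integral_bind_prob[OF _ _ assms])
     (auto simp: space_prob_algebra cong: measurable_cong_sets)

lemma invariant_kernel_pow:
  assumes inv: "\<mu> \<bind> \<kappa> = \<mu>" and sets: "sets \<mu> = sets borel"
  shows "\<mu> \<bind> kernel_pow \<kappa> n = \<mu>"
proof (induction n)
  case 0
  have "kernel_pow \<kappa> 0 = return borel" by auto
  then show ?case using bind_return''[of \<mu> borel] sets by simp
next
  case (Suc n)
  have "\<mu> \<bind> kernel_pow \<kappa> (Suc n) = (\<mu> \<bind> \<kappa>) \<bind> kernel_pow \<kappa> n"
    unfolding fun_eq_iff[THEN iffD2, OF allI, OF kernel_pow.simps(2)]
    using bind_assoc[OF _ measurable_prob_algebraD[OF kernel_pow_measurable],
        of \<kappa> \<mu> n] measurable_prob_algebraD[OF \<kappa>] sets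
    by (simp cong: measurable_cong_sets)
  then show ?case
    by (simp only: inv Suc)
qed

end

section \<open>Uniform convergence to the mean and a bounded Poisson solution\<close>

section \<open>Geometric ergodicity and the Poisson equation\<close>

text \<open>The constants are parameters separate from \<open>\<kappa>\<close> and
  \<open>\<mu>\<close>, so that one choice serves a whole family of kernels and every bound
  expressed through them is uniform over the family.\<close>

locale contracting_kernel =
  fixes \<kappa> :: "'a::second_countable_topology \<Rightarrow> 'a measure" and \<mu> :: "'a measure"
    and d :: "'a \<Rightarrow> 'a \<Rightarrow> real" and h :: "'a \<Rightarrow> real" and C t L K B :: real and k0 :: nat
  assumes kernel: "\<kappa> \<in> borel \<rightarrow>\<^sub>M prob_algebra borel"
    and prob: "prob_space \<mu>" and sets: "sets \<mu> = sets borel" and invariant: "\<mu> \<bind> \<kappa> = \<mu>"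
    and dist: "distance_like d"
    and C: "C \<ge> 1" and t: "0 < t" "t < 1" and k0: "k0 \<ge> 1"
    and contraction_1: "contraction_coeff d \<kappa> \<le> ennreal C"
    and contraction_k0: "contraction_coeff d (kernel_pow \<kappa> k0) \<le> ennreal t"
    and K: "K > 0" and ecc: "eccentricity d \<mu> y \<le> ennreal K"
    and h_measurable: "h \<in> borel_measurable borel" and h_bounded: "\<bar>h y\<bar> \<le> B"
    and L: "L > 0" and h_lipschitz: "lipschitz_wrt d L h"
begin

definition rate :: real where "rate = root k0 t"

text \<open>A Lipschitz constant for the \<open>n\<close>-step expectation of \<open>h\<close>. The
  prefactor \<open>C ^ k0 / t\<close> pays for an incomplete block: fewer than \<open>k0\<close>
  steps expand by at most \<open>C ^ k0\<close>, while \<open>rate ^ n\<close> has not yet dropped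
  below \<open>t\<close>.\<close>

definition envelope :: "nat \<Rightarrow> real" where "envelope n = C ^ k0 / t * L * rate ^ n"

lemma rate: "0 < rate" "rate < 1" "rate ^ k0 = t"
  using t k0 by (auto simp: rate_def)

lemma envelope_pos: "envelope n > 0"
  using rate t L C by (simp add: envelope_def)

lemma expectation_bounded: "\<bar>\<integral>x. h x \<partial>kernel_pow \<kappa> n y\<bar> \<le> B"
  using h_bounded[of y] by (intro abs_integral_le_prob prob_space_kernel_pow kernel h_bounded) simp

lemma expectation_measurable: "(\<lambda>y. \<integral>x. h x \<partial>kernel_pow \<kappa> n y) \<in> borel_measurable borel"
  by (rule measurable_compose[OF measurable_prob_algebraD[OF kernel_pow_measurable[OF kernel]]
        integral_measurable_subprob_algebra[OF h_measurable]])

lemma lipschitz_wrt_mono: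
  assumes "lipschitz_wrt d a g" "a \<le> b"
  shows "lipschitz_wrt d b g"
  unfolding lipschitz_wrt_def
proof (intro allI)
  fix x y
  have "\<bar>g x - g y\<bar> \<le> a * d x y"
    using assms(1) by (simp add: lipschitz_wrt_def)
  also have "\<dots> \<le> b * d x y"
    using assms(2) dist by (intro mult_right_mono) (auto simp: distance_like_def)
  finally show "\<bar>g x - g y\<bar> \<le> b * d x y" .
qed

text \<open>Each single step costs a factor \<open>C\<close>. This crude bound serves for fewer than
  \<open>k0\<close> steps.\<close>

lemma lipschitz_expectation_power:
  "lipschitz_wrt d (C ^ n * L) (\<lambda>y. \<integral>x. h x \<partial>kernel_pow \<kappa> n y)"
proof (induction n)
  case 0
  then show ?case
    using h_lipschitz h_measurable by (simp add: integral_return)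
next
  case (Suc n)
  have "lipschitz_wrt d (C * (C ^ n * L)) (\<lambda>y. \<integral>z. \<integral>x. h x \<partial>kernel_pow \<kappa> n z \<partial>\<kappa> y)"
    using C L by (intro lipschitz_wrt_integral_kernel[OF dist kernel contraction_1 _
          expectation_measurable expectation_bounded Suc]) auto
  then show ?case
    by (simp only: integral_kernel_pow_Suc[OF kernel h_measurable h_bounded] power_Suc mult.assoc)
qed

text \<open>The induction removes blocks of \<open>k0\<close> steps: one block contributes the
  factor \<open>t = rate ^ k0\<close>, exactly the ratio of \<open>envelope n\<close> to
  \<open>envelope (n - k0)\<close>.\<close>

lemma lipschitz_expectation:
  "lipschitz_wrt d (envelope n) (\<lambda>y. \<integral>x. h x \<partial>kernel_pow \<kappa> n y)"
proof (induction n rule: less_induct)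
  case (less n)
  show ?case
  proof (cases "n < k0")
    case True
    have "C ^ n \<le> C ^ k0"
      using C True by (intro power_increasing) auto
    moreover have "t \<le> rate ^ n"
      using power_decreasing[of n k0 rate] rate True by simp
    ultimately have "C ^ n * t \<le> C ^ k0 * rate ^ n"
      using C t by (intro mult_mono) auto
    then have "C ^ n * L \<le> envelope n"
      using t L by (simp add: envelope_def field_simps)
    then show ?thesis
      using lipschitz_wrt_mono[OF lipschitz_expectation_power] by blast
  next
    case False
    have "lipschitz_wrt d (t * envelope (n - k0))
        (\<lambda>y. \<integral>z. \<integral>x. h x \<partial>kernel_pow \<kappa> (n - k0) z \<partial>kernel_pow \<kappa> k0 y)"
      using t False k0 by (intro lipschitz_wrt_integral_kernel[OF dist kernel_pow_measurable[OF kernel]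
            contraction_k0 _ expectation_measurable expectation_bounded less] envelope_pos) auto
    moreover have "t * envelope (n - k0) = envelope n"
      using power_add[of rate k0 "n - k0"] False unfolding rate(3) by (simp add: envelope_def)
    ultimately show ?thesis
      using integral_kernel_pow_add[OF kernel h_measurable h_bounded, of k0 "n - k0"] False by simp
  qed
qed

lemma integral_expectation: "(\<integral>y. \<integral>x. h x \<partial>kernel_pow \<kappa> n y \<partial>\<mu>) = (\<integral>x. h x \<partial>\<mu>)"
  using integral_bind_prob[OF prob _ h_measurable h_bounded, of "kernel_pow \<kappa> n"]
    kernel_pow_measurable[OF kernel, of n] invariant_kernel_pow[OF kernel invariant sets, of n] sets
  by (simp cong: measurable_cong_sets)

text \<open>By invariance the \<open>n\<close>-step expectation has the same
  \<open>\<mu>\<close>-mean as \<open>h\<close>. Bounded eccentricity then turns its small Lipschitz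
  constant into a small uniform distance from that mean.\<close>

lemma expectation_convergence:
  "\<bar>(\<integral>x. h x \<partial>kernel_pow \<kappa> n y) - (\<integral>x. h x \<partial>\<mu>)\<bar> \<le> envelope n * K"
  using integral_diff_le_eccentricity[OF dist prob sets expectation_measurable expectation_bounded
      lipschitz_expectation envelope_pos ecc, of n y] K
  by (simp add: integral_expectation)

text \<open>The Neumann series of the identity minus \<open>\<kappa>\<close>, applied to the centred
  \<open>h\<close>.\<close>

definition poisson :: "'a \<Rightarrow> real" where
  "poisson y = (\<Sum>n. (\<integral>x. h x \<partial>kernel_pow \<kappa> n y) - (\<integral>x. h x \<partial>\<mu>))"

text \<open>The sum of the geometric series with terms \<open>envelope n * K\<close>; it involves
  neither \<open>\<kappa>\<close> nor \<open>\<mu>\<close>.\<close>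

definition poisson_bound :: real where
  "poisson_bound = C ^ k0 / t * L * K / (1 - rate)"

lemma poisson_bound_pos: "poisson_bound > 0"
  using C t L K rate by (simp add: poisson_bound_def)

lemma envelope_sums: "(\<lambda>n. envelope n * K) sums poisson_bound"
  using sums_mult[OF geometric_sums[of rate], of "C ^ k0 / t * L * K"] rate
  by (simp add: envelope_def poisson_bound_def mult_ac)

lemma poisson_summable:
  "summable (\<lambda>n. \<bar>(\<integral>x. h x \<partial>kernel_pow \<kappa> n y) - (\<integral>x. h x \<partial>\<mu>)\<bar>)"
  using expectation_convergence
  by (intro summable_comparison_test[OF _ sums_summable[OF envelope_sums]]) auto

lemma poisson_bounded: "\<bar>poisson y\<bar> \<le> poisson_bound"
proof -
  have "\<bar>poisson y\<bar> \<le> (\<Sum>n. \<bar>(\<integral>x. h x \<partial>kernel_pow \<kappa> n y) - (\<integral>x. h x \<partial>\<mu>)\<bar>)"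
    unfolding poisson_def by (rule summable_rabs[OF poisson_summable])
  also have "\<dots> \<le> (\<Sum>n. envelope n * K)"
    by (intro suminf_le expectation_convergence poisson_summable sums_summable[OF envelope_sums])
  finally show ?thesis
    using sums_unique[OF envelope_sums] by simp
qed

text \<open>Integrating against \<open>\<kappa> y\<close> shifts the series by one index, so only
  its zeroth term \<open>h y\<close> minus the mean is lost. The geometric bound justifies
  exchanging sum and integral.\<close>

lemma poisson_equation:
  "(\<integral>z. poisson z \<partial>\<kappa> y) = poisson y - (h y - (\<integral>x. h x \<partial>\<mu>))"
proof -
  let ?u = "\<lambda>n y. (\<integral>x. h x \<partial>kernel_pow \<kappa> n y) - (\<integral>x. h x \<partial>\<mu>)"
  have \<kappa>y: "prob_space (\<kappa> y)" "sets (\<kappa> y) = sets borel"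
    using measurable_space[OF kernel, of y] by (auto simp: space_prob_algebra)
  interpret \<kappa>y: prob_space "\<kappa> y" by (rule \<kappa>y)
  note [measurable_cong] = \<kappa>y(2)
  note [measurable] = expectation_measurable
  have int_E: "integrable (\<kappa> y) (\<lambda>z. \<integral>x. h x \<partial>kernel_pow \<kappa> n z)" for n
    by (rule integrable_bounded_prob[OF \<kappa>y(1) _ expectation_bounded]) measurable
  then have int: "integrable (\<kappa> y) (?u n)" for n
    by simp
  have abs_le: "(\<integral>z. \<bar>?u n z\<bar> \<partial>\<kappa> y) \<le> envelope n * K" for n
    using int expectation_convergence by (intro \<kappa>y.integral_le_const integrable_abs) auto
  have "(\<integral>z. poisson z \<partial>\<kappa> y) = (\<Sum>n. \<integral>z. ?u n z \<partial>\<kappa> y)"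
    unfolding poisson_def
  proof (rule integral_suminf)
    show "AE z in \<kappa> y. summable (\<lambda>n. norm (?u n z))"
      using poisson_summable by simp
    show "summable (\<lambda>n. \<integral>z. norm (?u n z) \<partial>\<kappa> y)"
      using abs_le by (intro summable_comparison_test[OF _ sums_summable[OF envelope_sums]]) auto
  qed (rule int)
  also have "(\<lambda>n. \<integral>z. ?u n z \<partial>\<kappa> y) = (\<lambda>n. ?u (Suc n) y)"
    using int_E by (simp add: integral_kernel_pow_Suc[OF kernel h_measurable h_bounded] \<kappa>y.prob_space
        del: kernel_pow.simps)
  also have "(\<Sum>n. ?u (Suc n) y) = poisson y - ?u 0 y"
    unfolding poisson_def
    by (rule suminf_split_head[OF summable_rabs_cancel[OF poisson_summable]])
  also have "?u 0 y = h y - (\<integral>x. h x \<partial>\<mu>)"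
    using h_measurable by (simp add: integral_return)
  finally show ?thesis .
qed

end

section \<open>Disintegration of the joint law of the past and the next state\<close>

section \<open>Conditional expectations given by a kernel\<close>

context
  fixes M F :: "'w measure" and N :: "'n measure" and Y :: "'w \<Rightarrow> 'n" and \<kappa> :: "'w \<Rightarrow> 'n measure"
  assumes prob_M: "prob_space M" and sub: "subalgebra M F"
    and Y[measurable]: "Y \<in> M \<rightarrow>\<^sub>M N" and \<kappa>[measurable]: "\<kappa> \<in> F \<rightarrow>\<^sub>M prob_algebra N"
    and transition: "\<And>B. B \<in> sets N \<Longrightarrow>
      AE \<omega> in M. real_cond_exp M F (indicator (Y -` B \<inter> space M)) \<omega> = measure (\<kappa> \<omega>) B"
begin

lemma kernel_prob_space: "\<omega> \<in> space M \<Longrightarrow> prob_space (\<kappa> \<omega>)"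
  and kernel_sets: "\<omega> \<in> space M \<Longrightarrow> sets (\<kappa> \<omega>) = sets N"
  using measurable_space[OF \<kappa>, of \<omega>] sub by (auto simp: space_prob_algebra subalgebra_def)

lemma measurable_graph: "(\<lambda>\<omega>. (\<omega>, Y \<omega>)) \<in> M \<rightarrow>\<^sub>M F \<Otimes>\<^sub>M N"
  using measurable_from_subalg[OF sub, of "\<lambda>\<omega>. \<omega>" F] by (intro measurable_Pair Y) simp

lemma measurable_graph_kernel: "(\<lambda>\<omega>. distr (\<kappa> \<omega>) (F \<Otimes>\<^sub>M N) (Pair \<omega>)) \<in> F \<rightarrow>\<^sub>M prob_algebra (F \<Otimes>\<^sub>M N)"
  by (rule measurable_distr_prob_space2[OF \<kappa>]) simp

lemma measurable_kernel_Pair: "\<omega> \<in> space M \<Longrightarrow> Pair \<omega> \<in> \<kappa> \<omega> \<rightarrow>\<^sub>M F \<Otimes>\<^sub>M N"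
  using sub kernel_sets[of \<omega>] by (auto simp: subalgebra_def cong: measurable_cong_sets)

text \<open>It suffices to compare the measures on rectangles \<open>A \<times> B\<close>, which are
  stable under intersection. There the identity is the defining property of conditional expectation
  tested on \<open>A\<close>; hence the first factor carries the sigma-algebra of \<open>F\<close>,
  not that of \<open>M\<close>.\<close>

lemma distr_graph_eq_bind:
  "distr M (F \<Otimes>\<^sub>M N) (\<lambda>\<omega>. (\<omega>, Y \<omega>)) =
    restr_to_subalg M F \<bind> (\<lambda>\<omega>. distr (\<kappa> \<omega>) (F \<Otimes>\<^sub>M N) (Pair \<omega>))"
  (is "?\<mu> = Giry_Monad.bind ?R ?J")
proof (rule measure_eqI_generator_eq)
  interpret prob_space M by (rule prob_M)
  interpret finite_measure_subalgebra M F
    by unfold_locales (rule sub)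
  interpret distr: prob_space "distr M (F \<Otimes>\<^sub>M N) (\<lambda>\<omega>. (\<omega>, Y \<omega>))"
    by (rule prob_space_distr[OF measurable_graph])
  let ?E = "{A \<times> B | A B. A \<in> sets F \<and> B \<in> sets N}"
  have J: "?J \<in> ?R \<rightarrow>\<^sub>M subprob_algebra (F \<Otimes>\<^sub>M N)"
    by (rule measurable_in_subalg[OF sub measurable_prob_algebraD[OF measurable_graph_kernel]])
  have R_nonempty: "space ?R \<noteq> {}"
    using not_empty by (simp add: space_restr_to_subalg)
  show "sets ?\<mu> = sigma_sets (space F \<times> space N) ?E"
    by (simp add: sets_pair_measure)
  show "sets (?R \<bind> ?J) = sigma_sets (space F \<times> space N) ?E"
    using sets_bind[OF sets_kernel[OF J] R_nonempty] by (simp add: sets_pair_measure)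
  show "range (\<lambda>_::nat. space F \<times> space N) \<subseteq> ?E" by auto
  show "emeasure ?\<mu> (space F \<times> space N) \<noteq> \<infinity>" by simp
  show "emeasure ?\<mu> X = emeasure (?R \<bind> ?J) X" if X_E: "X \<in> ?E" for X
  proof -
    obtain A B where X: "X = A \<times> B" and A: "A \<in> sets F" and B[measurable]: "B \<in> sets N"
      using X_E by auto
    have A'[measurable]: "A \<in> sets M"
      using A sub by (auto simp: subalgebra_def)
    have YB[measurable]: "Y -` B \<inter> space M \<in> sets M"
      by measurable
    have \<kappa>B: "(\<lambda>\<omega>. measure (\<kappa> \<omega>) B) \<in> borel_measurable F"
      by measurable
    have "emeasure (?R \<bind> ?J) X = (\<integral>\<^sup>+\<omega>. emeasure (?J \<omega>) (A \<times> B) \<partial>?R)"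
      unfolding X using A B by (intro emeasure_bind[OF R_nonempty J]) auto
    also have "\<dots> = (\<integral>\<^sup>+\<omega>. ennreal (indicator A \<omega> * measure (\<kappa> \<omega>) B) \<partial>?R)"
    proof (rule nn_integral_cong)
      fix \<omega> assume "\<omega> \<in> space ?R"
      then have \<omega>: "\<omega> \<in> space M"
        by (simp add: space_restr_to_subalg)
      interpret \<kappa>\<omega>: prob_space "\<kappa> \<omega>"
        by (rule kernel_prob_space[OF \<omega>])
      have "emeasure (?J \<omega>) (A \<times> B) = emeasure (\<kappa> \<omega>) (Pair \<omega> -` (A \<times> B) \<inter> space (\<kappa> \<omega>))"
        using A B by (intro emeasure_distr measurable_kernel_Pair \<omega>) auto
      also have "Pair \<omega> -` (A \<times> B) \<inter> space (\<kappa> \<omega>) = (if \<omega> \<in> A then B else {})"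
        using sets.sets_into_space[OF B] sets_eq_imp_space_eq[OF kernel_sets[OF \<omega>]] by auto
      finally show "emeasure (?J \<omega>) (A \<times> B) = ennreal (indicator A \<omega> * measure (\<kappa> \<omega>) B)"
        by (simp add: \<kappa>\<omega>.emeasure_eq_measure)
    qed
    also have "\<dots> = (\<integral>\<^sup>+\<omega>. ennreal (indicator A \<omega> * measure (\<kappa> \<omega>) B) \<partial>M)"
      by (intro nn_integral_subalgebra2[OF sub] measurable_compose[OF _ measurable_ennreal]
          borel_measurable_times borel_measurable_indicator A \<kappa>B)
    also have "\<dots> = (\<integral>\<^sup>+\<omega>. ennreal (indicator A \<omega> * real_cond_exp M F (indicator (Y -` B \<inter> space M)) \<omega>) \<partial>M)"
      using transition[OF B] by (intro nn_integral_cong_AE) auto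
    also have "\<dots> = ennreal (\<integral>\<omega>. indicator A \<omega> * real_cond_exp M F (indicator (Y -` B \<inter> space M)) \<omega> \<partial>M)"
    proof (rule nn_integral_eq_integral)
      show "integrable M (\<lambda>\<omega>. indicator A \<omega> * real_cond_exp M F (indicator (Y -` B \<inter> space M)) \<omega>)"
        using A by (intro real_cond_exp_intg integrable_const_bound[where B = 1])
           (auto simp: indicator_def)
      show "AE \<omega> in M. 0 \<le> indicator A \<omega> * real_cond_exp M F (indicator (Y -` B \<inter> space M)) \<omega>"
        using transition[OF B] by eventually_elim simp
    qed
    also have "(\<integral>\<omega>. indicator A \<omega> * real_cond_exp M F (indicator (Y -` B \<inter> space M)) \<omega> \<partial>M)
        = (\<integral>\<omega>. indicator A \<omega> * indicator (Y -` B \<inter> space M) \<omega> \<partial>M)"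
      using A by (intro real_cond_exp_intg integrable_const_bound[where B = 1])
         (auto simp: indicator_def)
    also have "\<dots> = measure M (A \<inter> (Y -` B \<inter> space M))"
      by (simp flip: indicator_inter_arith)
    also have "A \<inter> (Y -` B \<inter> space M) = (\<lambda>\<omega>. (\<omega>, Y \<omega>)) -` X \<inter> space M"
      by (auto simp: X)
    also have "ennreal (measure M \<dots>) = emeasure ?\<mu> X"
      using A B by (subst emeasure_distr[OF measurable_graph]) (auto simp: X emeasure_eq_measure)
    finally show ?thesis ..
  qed
qed (auto simp: Int_stable_pair_measure_generator dest: sets.sets_into_space)

text \<open>Given \<open>F\<close>, the first argument of \<open>v\<close> is frozen and only
  \<open>Y\<close> is averaged. This extends the transition law from fixed sets to functions that
  also depend on the past, such as a Poisson solution with a random index.\<close>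

lemma real_cond_exp_kernel:
  fixes v :: "'w \<Rightarrow> 'n \<Rightarrow> real"
  assumes v: "(\<lambda>(\<omega>, y). v \<omega> y) \<in> borel_measurable (F \<Otimes>\<^sub>M N)"
    and bounded: "\<And>\<omega> y. \<omega> \<in> space M \<Longrightarrow> y \<in> space N \<Longrightarrow> \<bar>v \<omega> y\<bar> \<le> B"
  shows "AE \<omega> in M. real_cond_exp M F (\<lambda>\<omega>. v \<omega> (Y \<omega>)) \<omega> = (\<integral>y. v \<omega> y \<partial>\<kappa> \<omega>)"
proof -
  interpret prob_space M by (rule prob_M)
  interpret finite_measure_subalgebra M F
    by unfold_locales (rule sub)
  have space_F: "space F = space M"
    using sub by (simp add: subalgebra_def)
  have prob_R: "prob_space (restr_to_subalg M F)"
    by (rule prob_space_restr_to_subalg[OF sub prob_M])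
  have graph_integral: "(\<integral>p. w p \<partial>distr (\<kappa> \<omega>) (F \<Otimes>\<^sub>M N) (Pair \<omega>)) = (\<integral>y. w (\<omega>, y) \<partial>\<kappa> \<omega>)"
    if "w \<in> borel_measurable (F \<Otimes>\<^sub>M N)" "\<omega> \<in> space M" for w :: "_ \<Rightarrow> real" and \<omega>
    using that by (intro integral_distr measurable_kernel_Pair)
  have kernel_integral_measurable: "(\<lambda>\<omega>. \<integral>y. w (\<omega>, y) \<partial>\<kappa> \<omega>) \<in> borel_measurable F"
    if "w \<in> borel_measurable (F \<Otimes>\<^sub>M N)" for w :: "_ \<Rightarrow> real"
    using measurable_compose[OF measurable_prob_algebraD[OF measurable_graph_kernel]
        integral_measurable_subprob_algebra[OF that]]
    by (rule measurable_cong[THEN iffD1, rotated]) (simp add: graph_integral[OF that] space_F)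
  have disintegration: "(\<integral>\<omega>. w (\<omega>, Y \<omega>) \<partial>M) = (\<integral>\<omega>. \<integral>y. w (\<omega>, y) \<partial>\<kappa> \<omega> \<partial>M)"
    if w: "w \<in> borel_measurable (F \<Otimes>\<^sub>M N)" and w_bounded: "\<And>p. p \<in> space (F \<Otimes>\<^sub>M N) \<Longrightarrow> \<bar>w p\<bar> \<le> B"
    for w :: "_ \<Rightarrow> real"
  proof -
    have "(\<integral>\<omega>. w (\<omega>, Y \<omega>) \<partial>M) = (\<integral>p. w p \<partial>distr M (F \<Otimes>\<^sub>M N) (\<lambda>\<omega>. (\<omega>, Y \<omega>)))"
      by (rule integral_distr[symmetric, OF measurable_graph w])
    also have "\<dots> = (\<integral>\<omega>. \<integral>p. w p \<partial>distr (\<kappa> \<omega>) (F \<Otimes>\<^sub>M N) (Pair \<omega>) \<partial>restr_to_subalg M F)"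
      unfolding distr_graph_eq_bind
      by (rule integral_bind_prob[OF prob_R measurable_in_subalg[OF sub measurable_graph_kernel] w w_bounded])
    also have "\<dots> = (\<integral>\<omega>. \<integral>y. w (\<omega>, y) \<partial>\<kappa> \<omega> \<partial>restr_to_subalg M F)"
      by (intro Bochner_Integration.integral_cong) (auto simp: graph_integral[OF w] space_restr_to_subalg)
    also have "\<dots> = (\<integral>\<omega>. \<integral>y. w (\<omega>, y) \<partial>\<kappa> \<omega> \<partial>M)"
      by (rule integral_subalgebra2[OF sub kernel_integral_measurable[OF w]])
    finally show ?thesis .
  qed
  have kernel_integral_F: "(\<lambda>\<omega>. \<integral>y. v \<omega> y \<partial>\<kappa> \<omega>) \<in> borel_measurable F"
    using kernel_integral_measurable[OF v] by simp
  show ?thesis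
  proof (rule real_cond_exp_charact)
    show "(\<lambda>\<omega>. \<integral>y. v \<omega> y \<partial>\<kappa> \<omega>) \<in> borel_measurable F"
      by (rule kernel_integral_F)
    show "integrable M (\<lambda>\<omega>. v \<omega> (Y \<omega>))"
      using measurable_compose[OF measurable_graph v] measurable_space[OF Y]
      by (intro integrable_const_bound[where B = B]) (auto intro!: bounded)
    show "integrable M (\<lambda>\<omega>. \<integral>y. v \<omega> y \<partial>\<kappa> \<omega>)"
    proof (rule integrable_const_bound[where B = B])
      \<comment> \<open>The point \<open>Y \<omega>\<close> shows that \<open>N\<close> has a
        nonempty space, so the bound on \<open>v\<close> forces \<open>B \<ge> 0\<close>.\<close>
      have "\<bar>\<integral>y. v \<omega> y \<partial>\<kappa> \<omega>\<bar> \<le> B" if \<omega>: "\<omega> \<in> space M" for \<omega>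
        using bounded[OF \<omega>] measurable_space[OF Y \<omega>] sets_eq_imp_space_eq[OF kernel_sets[OF \<omega>]]
        by (intro abs_integral_le_prob[OF kernel_prob_space[OF \<omega>]]) fastforce+
      then show "AE \<omega> in M. norm (\<integral>y. v \<omega> y \<partial>\<kappa> \<omega>) \<le> B"
        by simp
    qed (rule measurable_from_subalg[OF sub kernel_integral_F])
    fix A assume A: "A \<in> sets F"
    \<comment> \<open>Moving the test set \<open>A\<close> into the integrand reduces the
      characterisation of conditional expectation to the disintegration above.\<close>
    let ?w = "\<lambda>(\<omega>, y). indicator A \<omega> * v \<omega> y"
    have "?w \<in> borel_measurable (F \<Otimes>\<^sub>M N)"
      using v A unfolding case_prod_beta' by measurable
    moreover have "\<bar>?w p\<bar> \<le> B" if "p \<in> space (F \<Otimes>\<^sub>M N)" for p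
      using that bounded[of "fst p" "snd p"]
      by (auto simp: space_pair_measure space_F indicator_def split: prod.splits intro: order_trans[OF abs_ge_zero])
    ultimately have "(\<integral>\<omega>. ?w (\<omega>, Y \<omega>) \<partial>M) = (\<integral>\<omega>. \<integral>y. ?w (\<omega>, y) \<partial>\<kappa> \<omega> \<partial>M)"
      by (rule disintegration)
    then show "(\<integral>\<omega>\<in>A. v \<omega> (Y \<omega>) \<partial>M) = (\<integral>\<omega>\<in>A. (\<integral>y. v \<omega> y \<partial>\<kappa> \<omega>) \<partial>M)"
      by (simp add: set_lebesgue_integral_def)
  qed
qed

end

section \<open>Counting adaptations, and sums that almost telescope\<close>

section \<open>Adaptation times\<close>

text \<open>For \<open>\<beta> \<ge> 1\<close> the \<open>j\<close>-th block has length at least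
  \<open>j\<close>, so the first \<open>m\<close> blocks have total length at least
  \<open>m * (m + 1) / 2\<close>.\<close>

lemma square_le_air_time:
  assumes "\<beta> \<ge> 1"
  shows "m * m \<le> 2 * air_time \<beta> m"
proof (induction m)
  case (Suc m)
  have "real (Suc m) powr 1 \<le> real (Suc m) powr \<beta>"
    using assms by (intro powr_mono) auto
  then have "Suc m \<le> nat \<lceil>real (Suc m) powr \<beta>\<rceil>"
    by (simp add: le_nat_iff le_ceiling_iff)
  with Suc show ?case
    by (simp add: air_time_def)
qed simp

lemma air_time_interval:
  assumes "\<beta> \<ge> 1"
  obtains j where "air_time \<beta> j \<le> i" "i < air_time \<beta> (Suc j)"
proof -
  define k where "k = (LEAST k. i < air_time \<beta> k)"
  \<comment> \<open>Any index whose square exceeds \<open>2 * i\<close> would do;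
    \<open>2 * i + 1\<close> is one.\<close>
  have "i < air_time \<beta> (2 * i + 1)"
    using square_le_air_time[OF assms, of "2 * i + 1"] by simp
  then have k: "i < air_time \<beta> k"
    unfolding k_def by (rule LeastI)
  \<comment> \<open>The least such \<open>k\<close> is not 0 because
    \<open>air_time \<beta> 0 = 0\<close>.\<close>
  then obtain j where j: "k = Suc j"
    by (cases k) (auto simp: air_time_def)
  then have "\<not> i < air_time \<beta> j"
    using not_less_Least[of j "\<lambda>k. i < air_time \<beta> k"] by (simp add: k_def)
  with k j show thesis
    by (intro that[of j]) auto
qed

text \<open>If \<open>i + 2\<close> is the \<open>m\<close>-th adaptation time and
  \<open>i < n\<close>, then \<open>m * m \<le> 2 * (n + 1)\<close>. The shift by 2 matches the
  later sum, whose term \<open>i\<close> compares the parameters at times \<open>i + 1\<close> and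
  \<open>i + 2\<close>.\<close>

lemma card_air_times_le:
  assumes "\<beta> \<ge> 1"
  shows "real (card {i. i < n \<and> Suc (Suc i) \<in> range (air_time \<beta>)}) \<le> sqrt (2 * (real n + 1)) + 1"
proof -
  define r where "r = nat \<lfloor>sqrt (2 * (real n + 1))\<rfloor>"
  have "Suc (Suc i) \<in> air_time \<beta> ` {..r}" if i: "i < n" "Suc (Suc i) = air_time \<beta> m" for i m
  proof -
    have "m * m \<le> 2 * (n + 1)"
      using i square_le_air_time[OF assms, of m] by simp
    then have "real m * real m \<le> 2 * (real n + 1)"
      by (simp flip: of_nat_mult of_nat_le_iff[where 'a = real])
    then have "real m \<le> sqrt (2 * (real n + 1))"
      by (intro real_le_rsqrt) (simp add: power2_eq_square)
    then have "m \<le> r"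
      by (simp add: r_def le_nat_iff le_floor_iff)
    with i show ?thesis
      by simp
  qed
  then have "(\<lambda>i. Suc (Suc i)) ` {i. i < n \<and> Suc (Suc i) \<in> range (air_time \<beta>)} \<subseteq> air_time \<beta> ` {..r}"
    by blast
  then have "card ((\<lambda>i. Suc (Suc i)) ` {i. i < n \<and> Suc (Suc i) \<in> range (air_time \<beta>)}) \<le> card {..r}"
    using surj_card_le[of "{..r}" _ "air_time \<beta>"] by blast
  then have "card {i. i < n \<and> Suc (Suc i) \<in> range (air_time \<beta>)} \<le> r + 1"
    by (subst (asm) card_image) (auto simp: inj_on_def)
  moreover have "real r \<le> sqrt (2 * (real n + 1))"
    by (simp add: r_def)
  ultimately show ?thesis
    by linarith
qed

text \<open>With \<open>b i = a (Suc i)\<close> throughout, the sum would telescope to a boundary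
  term of size at most \<open>2 * G\<close>; each index violating this costs at most another
  \<open>2 * G\<close>.\<close>

lemma abs_sum_near_telescoping_le:
  fixes a b :: "nat \<Rightarrow> real"
  assumes "\<And>i. \<bar>a i\<bar> \<le> G" "\<And>i. \<bar>b i\<bar> \<le> G"
  shows "\<bar>\<Sum>i<n. a i - b i\<bar> \<le> 2 * G * (1 + real (card {i. i < n \<and> a (Suc i) \<noteq> b i}))"
proof -
  let ?S = "{i. i < n \<and> a (Suc i) \<noteq> b i}"
  have "(\<Sum>i<n. a i - b i) = (\<Sum>i<n. a i - a (Suc i)) + (\<Sum>i<n. a (Suc i) - b i)"
    by (simp flip: sum.distrib)
  also have "(\<Sum>i<n. a i - a (Suc i)) = a 0 - a n"
    by (rule sum_lessThan_telescope')
  also have "(\<Sum>i<n. a (Suc i) - b i) = (\<Sum>i\<in>?S. a (Suc i) - b i)"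
    by (rule sum.mono_neutral_right) auto
  finally have "\<bar>\<Sum>i<n. a i - b i\<bar> \<le> \<bar>a 0 - a n\<bar> + \<bar>\<Sum>i\<in>?S. a (Suc i) - b i\<bar>"
    by linarith
  also have "\<bar>\<Sum>i\<in>?S. a (Suc i) - b i\<bar> \<le> (\<Sum>i\<in>?S. 2 * G)"
  proof (intro order_trans[OF sum_abs] sum_mono)
    fix i
    show "\<bar>a (Suc i) - b i\<bar> \<le> 2 * G"
      using assms(1)[of "Suc i"] assms(2)[of i] by linarith
  qed
  also have "\<bar>a 0 - a n\<bar> \<le> 2 * G"
    using assms(1)[of 0] assms(1)[of n] by linarith
  finally show ?thesis
    by (simp add: algebra_simps)
qed

section \<open>The Poisson decomposition along the adaptive chain\<close>

section \<open>The adaptive chain\<close>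

context mcmc_family
begin

lemma P_pair_measurable: "(\<lambda>p. P (snd p) (fst p)) \<in> borel \<Otimes>\<^sub>M I \<rightarrow>\<^sub>M prob_algebra borel"
proof (rule measurable_prob_algebraI)
  have P: "prob_space (P \<gamma> y)" "sets (P \<gamma> y) = sets borel" if "\<gamma> \<in> space I" for \<gamma> y
    using measurable_space[OF P_kernel[OF that], of y] by (auto simp: space_prob_algebra)
  then show "prob_space (P (snd p) (fst p))" if "p \<in> space (borel \<Otimes>\<^sub>M I)" for p
    using that by (auto simp: space_pair_measure)
  show "(\<lambda>p. P (snd p) (fst p)) \<in> borel \<Otimes>\<^sub>M I \<rightarrow>\<^sub>M subprob_algebra borel"
    using P P_jointly_measurable
    by (intro measurable_subprob_algebra) (auto simp: space_pair_measure case_prod_beta' intro: prob_space_imp_subprob_space)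
qed

lemma kernel_pow_pair_measurable:
  "(\<lambda>p. kernel_pow (P (snd p)) n (fst p)) \<in> borel \<Otimes>\<^sub>M I \<rightarrow>\<^sub>M prob_algebra borel"
proof (induction n)
  case 0
  then show ?case by simp
next
  case (Suc n)
  have "(\<lambda>q. (snd q, snd (fst q))) \<in> (borel \<Otimes>\<^sub>M I) \<Otimes>\<^sub>M borel \<rightarrow>\<^sub>M borel \<Otimes>\<^sub>M I"
    by measurable
  from measurable_compose[OF this Suc]
  have "(\<lambda>(p, z). kernel_pow (P (snd p)) n z) \<in> (borel \<Otimes>\<^sub>M I) \<Otimes>\<^sub>M borel \<rightarrow>\<^sub>M prob_algebra borel"
    by (simp add: case_prod_beta')
  from measurable_bind_prob_space2[OF P_pair_measurable this] show ?case
    by simp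
qed

text \<open>The Poisson solution is later evaluated at a random index, which requires measurability
  jointly in state and index.\<close>

lemma poisson_pair_measurable:
  fixes h :: "'x \<times> 'p \<Rightarrow> real"
  assumes "h \<in> borel_measurable borel"
  shows "(\<lambda>p. \<Sum>n. (\<integral>x. h x \<partial>kernel_pow (P (snd p)) n (fst p)) - c) \<in> borel_measurable (borel \<Otimes>\<^sub>M I)"
  using measurable_compose[OF measurable_prob_algebraD[OF kernel_pow_pair_measurable]
      integral_measurable_subprob_algebra[OF assms]]
  by (intro borel_measurable_suminf borel_measurable_diff) auto

text \<open>The common first marginal \<open>\<nu>\<close> gives all kernels the same centring
  constant, although their invariant distributions differ.\<close>

lemma integral_pi_fst:
  fixes f :: "'x \<Rightarrow> real"
  assumes \<gamma>: "\<gamma> \<in> space I" and f: "f \<in> borel_measurable borel"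
  shows "(\<integral>y. f (fst y) \<partial>\<pi> \<gamma>) = (\<integral>x. f x \<partial>\<nu>)"
proof -
  have fst: "fst \<in> \<pi> \<gamma> \<rightarrow>\<^sub>M (borel :: 'x measure)"
    unfolding measurable_cong_sets[OF pi_sets[OF \<gamma>] refl] borel_prod[symmetric] by measurable
  have "distr (\<pi> \<gamma>) borel fst = \<nu>"
  proof (rule measure_eqI)
    fix A assume "A \<in> sets (distr (\<pi> \<gamma>) borel fst)"
    then have A: "A \<in> sets borel" by simp
    have "fst -` A \<inter> space (\<pi> \<gamma>) = A \<times> UNIV"
      using sets_eq_imp_space_eq[OF pi_sets[OF \<gamma>]] by auto
    then show "emeasure (distr (\<pi> \<gamma>) borel fst) A = emeasure \<nu> A"
      by (simp add: emeasure_distr[OF fst A] pi_marginal[OF \<gamma> A])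
  qed (simp add: nu_sets)
  then show ?thesis
    using integral_distr[OF fst f] by simp
qed

end

context air_mcmc
begin

abbreviation H :: "nat \<Rightarrow> 'w measure" where "H n \<equiv> history_algebra M I Y \<Gamma> n"

lemma history_generator_subset:
  "(\<Union>i\<le>n. {Y i -` A \<inter> space M |A. A \<in> sets borel} \<union> {\<Gamma> i -` B \<inter> space M |B. B \<in> sets I}) \<subseteq> sets M"
  using Y_measurable Gamma_measurable by (auto intro: measurable_sets)

lemma space_history: "space (H n) = space M"
  by (simp add: history_algebra_def space_measure_of_conv)

lemma sets_history: "sets (H n) = sigma_sets (space M)
    (\<Union>i\<le>n. {Y i -` A \<inter> space M |A. A \<in> sets borel} \<union> {\<Gamma> i -` B \<inter> space M |B. B \<in> sets I})"
  unfolding history_algebra_def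
  by (intro sets_measure_of order_trans[OF history_generator_subset sets.space_closed])

lemma subalgebra_history: "subalgebra M (H n)"
  unfolding subalgebra_def sets_history space_history
  using sets.sigma_sets_subset[OF history_generator_subset] by simp

lemma history_mono: "sets (H n) \<subseteq> sets (H (Suc n))"
  unfolding sets_history by (intro sigma_sets_mono') (auto simp: atMost_Suc)

lemma Y_history: "i \<le> n \<Longrightarrow> Y i \<in> H n \<rightarrow>\<^sub>M borel"
  by (rule measurableI) (auto simp: space_history sets_history intro!: sigma_sets.Basic)

lemma Gamma_history: "i \<le> n \<Longrightarrow> \<Gamma> i \<in> H n \<rightarrow>\<^sub>M I"
  using measurable_space[OF Gamma_measurable]
  by (intro measurableI) (auto simp: space_history sets_history intro!: sigma_sets.Basic)

lemma Gamma_in_space: "\<omega> \<in> space M \<Longrightarrow> \<Gamma> n \<omega> \<in> space I"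
  using measurable_space[OF Gamma_measurable] .

lemma kernel_history: "(\<lambda>\<omega>. P (\<Gamma> n \<omega>) (Y n \<omega>)) \<in> H n \<rightarrow>\<^sub>M prob_algebra borel"
  using measurable_compose[OF measurable_Pair[OF Y_history Gamma_history] P_pair_measurable]
  by simp

lemma cond_exp_next:
  fixes v :: "'w \<Rightarrow> 'x \<times> 'p \<Rightarrow> real"
  assumes "(\<lambda>(\<omega>, y). v \<omega> y) \<in> borel_measurable (H n \<Otimes>\<^sub>M borel)"
    and "\<And>\<omega> y. \<omega> \<in> space M \<Longrightarrow> \<bar>v \<omega> y\<bar> \<le> B"
  shows "AE \<omega> in M. real_cond_exp M (H n) (\<lambda>\<omega>. v \<omega> (Y (Suc n) \<omega>)) \<omega> = (\<integral>y. v \<omega> y \<partial>P (\<Gamma> n \<omega>) (Y n \<omega>))"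
  using real_cond_exp_kernel[OF prob_space_axioms subalgebra_history Y_measurable kernel_history
      transition assms] by simp

text \<open>Within a block the parameter is constant, so a change between \<open>i\<close> and
  \<open>i + 1\<close> means that \<open>i + 1\<close> starts the next block.\<close>

lemma adaptation_time:
  assumes "\<beta> \<ge> 1" "\<omega> \<in> space M" "\<Gamma> (Suc i) \<omega> \<noteq> \<Gamma> i \<omega>"
  shows "Suc i \<in> range (air_time \<beta>)"
proof -
  obtain j where j: "air_time \<beta> j \<le> i" "i < air_time \<beta> (Suc j)"
    using air_time_interval[OF assms(1)] .
  have "\<not> Suc i < air_time \<beta> (Suc j)"
    using increasingly_rare[of i j "Suc i" \<omega>] assms j by fastforce
  with j have "Suc i = air_time \<beta> (Suc j)"
    by simp
  then show ?thesis
    by blast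
qed

lemma strong_law_contracting:
  fixes d :: "'x \<times> 'p \<Rightarrow> 'x \<times> 'p \<Rightarrow> real" and h :: "'x \<times> 'p \<Rightarrow> real" and C t L K B c \<epsilon> :: real
  assumes beta: "\<beta> \<ge> 1" and eps: "\<epsilon> > 0"
    and contracting: "\<And>\<gamma>. \<gamma> \<in> space I \<Longrightarrow> contracting_kernel (P \<gamma>) (\<pi> \<gamma>) d h C t L K B k0"
    and mean: "\<And>\<gamma>. \<gamma> \<in> space I \<Longrightarrow> (\<integral>x. h x \<partial>\<pi> \<gamma>) = c"
  shows "AE \<omega> in M. (\<lambda>n. 1 / (sqrt (real n) * ln (real n) powr (1/2 + \<epsilon>)) *
    (\<Sum>j=1..n. h (Y j \<omega>) - c)) \<longlonglongrightarrow> 0"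
proof -
  have h: "h \<in> borel_measurable borel"
    using contracting[OF gamma0] by (rule contracting_kernel.h_measurable)
  define G where "G = contracting_kernel.poisson_bound C t L K k0"
  have G: "G > 0"
    using contracting_kernel.poisson_bound_pos[OF contracting[OF gamma0]] by (simp add: G_def)
  \<comment> \<open>With the common mean \<open>c\<close> the series no longer mentions
    \<open>\<pi> \<gamma>\<close>, and in this form it is jointly measurable in state and
    index.\<close>
  define g where "g \<gamma> y = (\<Sum>n. (\<integral>x. h x \<partial>kernel_pow (P \<gamma>) n y) - c)" for \<gamma> y
  have g_eq: "g \<gamma> = contracting_kernel.poisson (P \<gamma>) (\<pi> \<gamma>) h" if "\<gamma> \<in> space I" for \<gamma>
    using contracting_kernel.poisson_def[OF contracting[OF that]] mean[OF that]
    by (intro ext) (simp add: g_def)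
  have g_bounded: "\<bar>g \<gamma> y\<bar> \<le> G" if "\<gamma> \<in> space I" for \<gamma> y
    using contracting_kernel.poisson_bounded[OF contracting[OF that]] g_eq[OF that] by (simp add: G_def)
  have g_poisson: "(\<integral>z. g \<gamma> z \<partial>P \<gamma> y) = g \<gamma> y - (h y - c)" if "\<gamma> \<in> space I" for \<gamma> y
    using contracting_kernel.poisson_equation[OF contracting[OF that]] g_eq[OF that] mean[OF that] by simp
  have g_measurable: "(\<lambda>p. g (snd p) (fst p)) \<in> borel_measurable (borel \<Otimes>\<^sub>M I)"
    unfolding g_def by (rule poisson_pair_measurable[OF h])
  have P: "prob_space (P \<gamma> y)" "sets (P \<gamma> y) = sets borel" if "\<gamma> \<in> space I" for \<gamma> y
    using measurable_space[OF P_kernel[OF that], of y] by (auto simp: space_prob_algebra)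
  define a where "a i \<omega> = g (\<Gamma> i \<omega>) (Y i \<omega>)" for i \<omega>
  define b where "b i \<omega> = g (\<Gamma> i \<omega>) (Y (Suc i) \<omega>)" for i \<omega>
  \<comment> \<open>By the Poisson equation this is the integral of \<open>g\<close> under the
    transition law. The present form shows measurability for \<open>H i\<close>; the integral form
    yields the bound \<open>G\<close>.\<close>
  define Pg where "Pg i \<omega> = a i \<omega> - (h (Y i \<omega>) - c)" for i \<omega>
  have Pg_bounded: "\<bar>Pg i \<omega>\<bar> \<le> G" if "\<omega> \<in> space M" for i \<omega>
  proof -
    note \<gamma> = Gamma_in_space[OF that, of i]
    have "\<bar>\<integral>z. g (\<Gamma> i \<omega>) z \<partial>P (\<Gamma> i \<omega>) (Y i \<omega>)\<bar> \<le> G"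
      using G by (intro abs_integral_le_prob[OF P(1)[OF \<gamma>] g_bounded[OF \<gamma>]]) simp
    then show ?thesis
      by (simp add: Pg_def a_def g_poisson[OF \<gamma>])
  qed
  have Pg_measurable: "Pg i \<in> borel_measurable (H i)" for i
    unfolding Pg_def a_def
    using measurable_compose[OF measurable_Pair[OF Y_history Gamma_history] g_measurable, of i i i]
      measurable_compose[OF Y_history h, of i i]
    by (intro borel_measurable_diff) auto
  \<comment> \<open>The sum to be estimated starts at \<open>j = 1\<close>, so \<open>D i\<close> is
    the innovation of the step from time \<open>i + 1\<close> to \<open>i + 2\<close>, and the
    filtration is shifted accordingly.\<close>
  define D where "D i \<omega> = b (Suc i) \<omega> - Pg (Suc i) \<omega>" for i \<omega>
  interpret D: bounded_martingale_differences M "\<lambda>i. H (Suc i)" D "2 * G"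
  proof unfold_locales
    fix i
    show "D i \<in> borel_measurable (H (Suc (Suc i)))"
    proof -
      have "subalgebra (H (Suc (Suc i))) (H (Suc i))"
        using history_mono[of "Suc i"] by (simp add: subalgebra_def space_history)
      from measurable_from_subalg[OF this Pg_measurable] show ?thesis
        unfolding D_def b_def
        using measurable_compose[OF measurable_Pair[OF Y_history Gamma_history] g_measurable,
            of "Suc (Suc i)" "Suc (Suc i)" "Suc i"]
        by (intro borel_measurable_diff) auto
    qed
    show "\<bar>D i \<omega>\<bar> \<le> 2 * G" if "\<omega> \<in> space M" for \<omega>
      using g_bounded[OF Gamma_in_space[OF that, of "Suc i"], of "Y (Suc (Suc i)) \<omega>"] Pg_bounded[OF that, of "Suc i"]
      by (simp add: D_def b_def)
    show "AE \<omega> in M. real_cond_exp M (H (Suc i)) (D i) \<omega> = 0"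
    proof -
      let ?v = "\<lambda>\<omega> y. g (\<Gamma> (Suc i) \<omega>) y - Pg (Suc i) \<omega>"
      have "(\<lambda>q. (snd q, \<Gamma> (Suc i) (fst q))) \<in> H (Suc i) \<Otimes>\<^sub>M borel \<rightarrow>\<^sub>M borel \<Otimes>\<^sub>M I"
        using measurable_compose[OF measurable_fst Gamma_history] by (intro measurable_Pair) auto
      from borel_measurable_diff[OF measurable_compose[OF this g_measurable]
          measurable_compose[OF measurable_fst Pg_measurable]]
      have "(\<lambda>(\<omega>, y). ?v \<omega> y) \<in> borel_measurable (H (Suc i) \<Otimes>\<^sub>M borel)"
        by (simp add: case_prod_beta')
      moreover have "\<bar>?v \<omega> y\<bar> \<le> 2 * G" if "\<omega> \<in> space M" for \<omega> y
        using g_bounded[OF Gamma_in_space[OF that, of "Suc i"], of y] Pg_bounded[OF that, of "Suc i"]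
        by simp
      ultimately have "AE \<omega> in M. real_cond_exp M (H (Suc i)) (\<lambda>\<omega>. ?v \<omega> (Y (Suc (Suc i)) \<omega>)) \<omega>
          = (\<integral>y. ?v \<omega> y \<partial>P (\<Gamma> (Suc i) \<omega>) (Y (Suc i) \<omega>))"
        by (rule cond_exp_next)
      moreover have "(\<integral>y. ?v \<omega> y \<partial>P (\<Gamma> (Suc i) \<omega>) (Y (Suc i) \<omega>)) = 0" if "\<omega> \<in> space M" for \<omega>
      proof -
        note \<gamma> = Gamma_in_space[OF that, of "Suc i"]
        interpret P: prob_space "P (\<Gamma> (Suc i) \<omega>) (Y (Suc i) \<omega>)"
          by (rule P(1)[OF \<gamma>])
        have "g (\<Gamma> (Suc i) \<omega>) \<in> borel_measurable borel"
          using measurable_compose[OF measurable_Pair2'[OF \<gamma>] g_measurable] by simp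
        then have "integrable (P (\<Gamma> (Suc i) \<omega>) (Y (Suc i) \<omega>)) (g (\<Gamma> (Suc i) \<omega>))"
          using P(2)[OF \<gamma>] by (intro integrable_bounded_prob[OF P(1)[OF \<gamma>] _ g_bounded[OF \<gamma>]])
             (simp cong: measurable_cong_sets)
        then show ?thesis
          by (simp add: g_poisson[OF \<gamma>] P.prob_space Pg_def a_def)
      qed
      ultimately show ?thesis
        unfolding D_def b_def by (auto elim!: AE_mp intro!: AE_I2)
    qed
  qed (use subalgebra_history history_mono G in auto)
  show ?thesis
    using D.strong_law[OF eps] AE_space
  proof eventually_elim
    case (elim \<omega>)
    define A where "A n = sqrt (real n) * ln (real n) powr (1/2 + \<epsilon>)" for n
    define R where "R n = (\<Sum>i<n. a (Suc i) \<omega> - b (Suc i) \<omega>)" for n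
    \<comment> \<open>Here \<open>h (Y j) - c = a j - Pg j\<close>; inserting \<open>b j\<close>
      separates the innovation \<open>b j - Pg j\<close> from the almost telescoping
      \<open>a j - b j\<close>.\<close>
    have decomposition: "(\<Sum>j=1..n. h (Y j \<omega>) - c) = (\<Sum>i<n. D i \<omega>) + R n" for n
    proof -
      have "(\<Sum>j=1..n. h (Y j \<omega>) - c) = (\<Sum>i<n. h (Y (Suc i) \<omega>) - c)"
        by (rule sum.reindex_bij_witness[of _ Suc "\<lambda>j. j - 1"]) auto
      also have "\<dots> = (\<Sum>i<n. D i \<omega>) + R n"
        by (simp add: R_def D_def Pg_def flip: sum.distrib)
      finally show ?thesis .
    qed
    have R_bound: "\<bar>R n\<bar> \<le> 2 * G * (2 + sqrt (2 * (real n + 1)))" for n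
    proof -
      let ?S = "{i. i < n \<and> a (Suc (Suc i)) \<omega> \<noteq> b (Suc i) \<omega>}"
      let ?T = "{i. i < n \<and> Suc (Suc i) \<in> range (air_time \<beta>)}"
      \<comment> \<open>Without an adaptation at \<open>i + 1\<close> both sides evaluate the same
        Poisson solution at \<open>Y (Suc i)\<close>.\<close>
      have "b i \<omega> = a (Suc i) \<omega>" if "Suc i \<notin> range (air_time \<beta>)" for i
        using adaptation_time[OF beta elim(2), of i] that by (simp only: a_def b_def) metis
      then have "?S \<subseteq> ?T"
        by (intro Collect_mono) metis
      then have card: "card ?S \<le> card ?T"
        by (intro card_mono) auto
      have "\<bar>R n\<bar> \<le> 2 * G * (1 + real (card ?S))"
        unfolding R_def
        by (intro abs_sum_near_telescoping_le) (auto simp: a_def b_def intro!: g_bounded Gamma_in_space elim)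
      also have "\<dots> \<le> 2 * G * (2 + sqrt (2 * (real n + 1)))"
        using card card_air_times_le[OF beta, of n] G by (intro mult_left_mono) auto
      finally show ?thesis .
    qed
    have "(\<lambda>n. R n / A n) \<longlonglongrightarrow> 0"
    proof (rule Lim_null_comparison)
      show "\<forall>\<^sub>F n in sequentially. norm (R n / A n) \<le> 2 * G * ((2 + sqrt (2 * (real n + 1))) / A n)"
        using R_bound by (intro always_eventually allI)
          (simp add: A_def abs_mult divide_right_mono)
      \<comment> \<open>The remainder is only of order \<open>sqrt n\<close>, so the positive power
        of the logarithm in \<open>A n\<close> makes the quotient vanish.\<close>
      have blocks: "(\<lambda>n. (2 + sqrt (2 * (real n + 1))) / sqrt (real n)) \<longlonglongrightarrow> sqrt 2"
        by (real_asymp simp: powr_half_sqrt)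
      have "(\<lambda>n. 1 / ln (real n) powr p) \<longlonglongrightarrow> 0" if "p > 0" for p :: real
        using that by real_asymp
      from tendsto_mult[OF blocks this[of "1/2 + \<epsilon>"]]
      have "(\<lambda>n. (2 + sqrt (2 * (real n + 1))) / A n) \<longlonglongrightarrow> 0"
        using eps by (simp only: A_def times_divide_times_eq mult_1_right mult_zero_right)
      from tendsto_mult_left[OF this, of "2 * G"]
      show "(\<lambda>n. 2 * G * ((2 + sqrt (2 * (real n + 1))) / A n)) \<longlonglongrightarrow> 0"
        by (simp only: mult_zero_right)
    qed
    from tendsto_add[OF elim(1) this[unfolded A_def]] show ?case
      by (simp only: decomposition times_divide_eq_left mult_1_left add_divide_distrib add_0)
  qed
qed

end

theorem theorem3p5:
  fixes \<nu> :: "'x::polish_space measure"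
    and I :: "'i measure"
    and \<pi> :: "'i \<Rightarrow> ('x \<times> 'p::polish_space) measure"
    and P :: "'i \<Rightarrow> 'x \<times> 'p \<Rightarrow> ('x \<times> 'p) measure"
    and \<Omega> :: "'w measure"
    and \<beta> :: real
    and Y :: "nat \<Rightarrow> 'w \<Rightarrow> 'x \<times> 'p"
    and \<Gamma> :: "nat \<Rightarrow> 'w \<Rightarrow> 'i"
    and y0 :: "'x \<times> 'p"
    and \<gamma>0 :: 'i
    and d :: "'x \<times> 'p \<Rightarrow> 'x \<times> 'p \<Rightarrow> real"
    and M \<tau> K L \<epsilon> :: real
    and k0 :: nat
    and f :: "'x \<Rightarrow> real"
    and h :: "'x \<times> 'p \<Rightarrow> real"
  assumes chain: "air_mcmc \<nu> I \<pi> P \<Omega> \<beta> Y \<Gamma> y0 \<gamma>0"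
    and beta: "\<beta> \<ge> 1"
    and d: "distance_like d"
    and M: "M \<ge> 1"
    and tau: "0 \<le> \<tau>" "\<tau> < 1"
    and k0: "k0 \<ge> 1"
    and contraction_1: "\<And>\<gamma>. \<gamma> \<in> space I \<Longrightarrow> contraction_coeff d (P \<gamma>) \<le> ennreal M"
    and contraction_k0: "\<And>\<gamma>. \<gamma> \<in> space I \<Longrightarrow> contraction_coeff d (kernel_pow (P \<gamma>) k0) \<le> ennreal \<tau>"
    and K: "K > 0"
    and eccentricity: "\<And>\<gamma> y. \<gamma> \<in> space I \<Longrightarrow> eccentricity d (\<pi> \<gamma>) y \<le> ennreal K"
    and f: "f \<in> borel_measurable borel"
    and h: "h = (\<lambda>(x, \<phi>). f x)"
    and h_bounded: "bounded (range h)"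
    and L: "L > 0"
    and h_lipschitz: "lipschitz_wrt d L h"
    and eps: "\<epsilon> > 0"
  shows "AE \<omega> in \<Omega>. (\<lambda>n. 1 / (sqrt (real n) * ln (real n) powr (1/2 + \<epsilon>)) *
           (\<Sum>j=1..n. f (fst (Y j \<omega>)) - (\<integral>x. f x \<partial>\<nu>))) \<longlonglongrightarrow> 0"
proof -
  interpret air_mcmc \<nu> I \<pi> P \<Omega> \<beta> Y \<Gamma> y0 \<gamma>0
    by (rule chain)
  define t where "t = max \<tau> (1/2)" \<comment> \<open>a positive rate, so that it has a positive \<open>k0\<close>-th root\<close>
  have t: "0 < t" "t < 1" "ennreal \<tau> \<le> ennreal t"
    using tau by (auto simp: t_def intro: ennreal_leI)
  obtain B where B: "\<bar>h y\<bar> \<le> B" for y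
    using h_bounded unfolding bounded_real by blast
  have h_eq: "h = (\<lambda>y. f (fst y))"
    using h by (auto simp: fun_eq_iff)
  have h_measurable: "h \<in> borel_measurable borel"
    unfolding h_eq borel_prod[symmetric] using f by measurable
  have "contracting_kernel (P \<gamma>) (\<pi> \<gamma>) d h M t L K B k0" if "\<gamma> \<in> space I" for \<gamma>
    by (rule contracting_kernel.intro[OF P_kernel[OF that] pi_prob[OF that] pi_sets[OF that]
          pi_invariant[OF that] d M t(1,2) k0 contraction_1[OF that]
          order_trans[OF contraction_k0[OF that] t(3)] K eccentricity[OF that] h_measurable B L h_lipschitz])
  moreover have "(\<integral>x. h x \<partial>\<pi> \<gamma>) = (\<integral>x. f x \<partial>\<nu>)" if "\<gamma> \<in> space I" for \<gamma>
    unfolding h_eq by (rule integral_pi_fst[OF that f])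
  ultimately have "AE \<omega> in \<Omega>. (\<lambda>n. 1 / (sqrt (real n) * ln (real n) powr (1/2 + \<epsilon>)) *
      (\<Sum>j=1..n. h (Y j \<omega>) - (\<integral>x. f x \<partial>\<nu>))) \<longlonglongrightarrow> 0"
    by (rule strong_law_contracting[OF beta eps])
  then show ?thesis
    by (simp add: h_eq)
qed

end
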